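(* Assume the Riemann hypothesis. Let $0<\alpha\le 1$. Let $\{\tilde t_0\}$ be a sequence of positive real numbers with $\tilde t_0\to+\infty$ such that, for each $\tilde t_0$ in the sequence: there are two neighboring ordinates $0<\tilde\gamma'<\tilde\gamma''$ of zeros $\tfrac12+i\tilde\gamma'$, $\tfrac12+i\tilde\gamma''$ of $\zeta$ with $\tilde\gamma'<\tilde t_0<\tilde\gamma''$; $Z'(\tilde t_0)=0$; and $$\left|\zeta\left(\tfrac12+i\tilde t_0\right)\right|>\frac{1}{\tilde t_0^{\,\alpha}}.$$ Put $\Delta(\tilde t_0)=\min\{\tilde t_0-\tilde\gamma',\ \tilde\gamma''-\tilde t_0\}$. Then $$\Delta(\tilde t_0)>\frac{1}{(\tilde\gamma')^{\alpha}}$$ for all members $\tilde t_0$ of the sequence that are sufficiently large.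
   Context: $\zeta$ is the Riemann zeta function. For real $t>0$, $Z(t)=e^{i\vartheta(t)}\zeta(\tfrac12+it)$, where $\vartheta(t)=\operatorname{Im}\log\Gamma(\tfrac14+\tfrac{it}{2})-\tfrac{t}{2}\ln\pi$ is the Riemann–Siegel theta function (continuous branch with $\vartheta(0)=0$); $Z$ is real-valued and smooth. Neighboring ordinates $\gamma'<\gamma''$ means that $\tfrac12+i\gamma'$ and $\tfrac12+i\gamma''$ are zeros of $\zeta$ and there is no zero $\tfrac12+i\gamma$ of $\zeta$ with $\gamma'<\gamma<\gamma''$. *)

theory Defs
  imports "HOL-Complex_Analysis.Complex_Analysis"
begin

subsection \<open>Existence of the analytic continuation of the zeta series\<close>

lemma holomorphic_on_suminf_local:
  fixes f :: "nat \<Rightarrow> complex \<Rightarrow> complex"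
  assumes S: "open S" and hol: "\<And>n. f n holomorphic_on S"
    and bound: "\<And>x. x \<in> S \<Longrightarrow> \<exists>d h. 0 < d \<and> summable h \<and> (\<forall>n. \<forall>y\<in>ball x d \<inter> S. norm (f n y) \<le> h n)"
  shows "(\<lambda>x. \<Sum>n. f n x) holomorphic_on S"
proof -
  have "\<exists>g g'. \<forall>x\<in>S. ((\<lambda>n. f n x) sums g x) \<and> ((\<lambda>n. deriv (f n) x) sums g' x) \<and> (g has_field_derivative g' x) (at x)"
  proof (rule series_and_derivative_comparison_local[OF S])
    show "(f n has_field_derivative deriv (f n) x) (at x)" if "x \<in> S" for n x
      using holomorphic_derivI[OF hol S that] .
    show "\<exists>d h. 0 < d \<and> summable h \<and> (\<forall>\<^sub>F n in sequentially. \<forall>y\<in>ball x d \<inter> S. norm (f n y) \<le> h n)"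
      if "x \<in> S" for x
    proof -
      obtain d h where dh: "0 < d" "summable h" "\<And>n y. y \<in> ball x d \<inter> S \<Longrightarrow> norm (f n y) \<le> h n"
        using bound[OF \<open>x \<in> S\<close>] by blast
      show ?thesis
        by (intro exI[of _ d] exI[of _ h] conjI always_eventually allI ballI) (use dh in auto)
    qed
  qed
  then obtain g g' where *: "\<And>x. x \<in> S \<Longrightarrow> (\<lambda>n. f n x) sums g x"
      "\<And>x. x \<in> S \<Longrightarrow> (g has_field_derivative g' x) (at x)" by blast
  have "g holomorphic_on S"
    using *(2) S holomorphic_on_open by blast
  moreover have "g x = (\<Sum>n. f n x)" if "x \<in> S" for x
    using *(1)[OF that] by (simp add: sums_iff)
  ultimately show ?thesis by (rule holomorphic_transform)
qed

definition zeta_remainder :: "nat \<Rightarrow> nat \<Rightarrow> complex \<Rightarrow> complex" where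
  "zeta_remainder K n s =
     (\<Sum>k\<le>K. ((1 - s) gchoose k) * of_nat (Suc n) powr (1 - s - of_nat k))
       - of_nat (Suc (Suc n)) powr (1 - s)"

lemma norm_zeta_remainder_le:
  assumes "Re s \<ge> - real K"
  shows "norm (zeta_remainder K n s)
           \<le> (\<Prod>j\<le>K. norm (1 - s - of_nat j)) * real (Suc n) powr (- Re s - real K)"
proof -
  define a where "a = 1 - s"
  define f where "f = (\<lambda>i x. (\<Prod>j<i. a - of_nat j) * x powr (a - of_nat i))"
  define S where "S = closed_segment (of_nat (Suc n)) (of_nat (Suc (Suc n)) :: complex)"
  define B where "B = (\<Prod>j\<le>K. norm (1 - s - of_nat j)) * real (Suc n) powr (- Re s - real K)"
  have S: "Re x \<ge> real (Suc n) \<and> x \<in> \<real> \<and> x \<notin> \<real>\<^sub>\<le>\<^sub>0" if "x \<in> S" for x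
  proof -
    from that obtain u where u: "0 \<le> u" "x = (1 - u) *\<^sub>R of_nat (Suc n) + u *\<^sub>R of_nat (Suc (Suc n))"
      by (auto simp: S_def in_segment)
    have "x = complex_of_real (real (Suc n) + u)"
      using u by (simp add: algebra_simps scaleR_conv_of_real)
    thus ?thesis using u(1) by (auto simp: complex_nonpos_Reals_iff)
  qed
  have "cmod (f 0 (of_nat (Suc (Suc n)))
       - (\<Sum>i\<le>K. f i (of_nat (Suc n)) * (of_nat (Suc (Suc n)) - of_nat (Suc n)) ^ i / fact i))
      \<le> B * cmod (of_nat (Suc (Suc n)) - of_nat (Suc n)) ^ Suc K / fact K"
  proof (rule complex_Taylor[where S = S])
    show "convex S" by (simp add: S_def)
    fix i x assume x: "x \<in> S"
    have x': "x \<notin> \<real>\<^sub>\<le>\<^sub>0" using S[OF x] by blast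
    show "(f i has_field_derivative f (Suc i) x) (at x within S)"
      unfolding f_def using x'
      by (auto intro!: derivative_eq_intros simp: algebra_simps)
  next
    fix x assume x: "x \<in> S"
    have "cmod (x powr (a - of_nat (Suc K))) = Re x powr (- Re s - real K)"
      using S[OF x] by (subst norm_powr_real_powr) (auto simp: a_def)
    also have "\<dots> \<le> real (Suc n) powr (- Re s - real K)"
      using S[OF x] assms by (intro powr_mono2') auto
    finally show "cmod (f (Suc K) x) \<le> B"
      unfolding f_def B_def norm_mult prod_norm [symmetric] lessThan_Suc_atMost
      by (intro mult_mono) (auto simp: a_def intro: prod_nonneg)
  qed (auto simp: S_def)
  also have "f 0 (of_nat (Suc (Suc n))) = of_nat (Suc (Suc n)) powr (1 - s)"
    by (simp add: f_def a_def)
  also have "(\<Sum>i\<le>K. f i (of_nat (Suc n)) * (of_nat (Suc (Suc n)) - of_nat (Suc n)) ^ i / fact i)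
     = (\<Sum>k\<le>K. ((1 - s) gchoose k) * of_nat (Suc n) powr (1 - s - of_nat k))"
    by (intro sum.cong refl) (simp add: f_def a_def gbinomial_prod_rev atLeast0LessThan)
  also have "cmod (of_nat (Suc (Suc n)) - of_nat (Suc n)) = 1" by simp
  finally have "norm (zeta_remainder K n s) \<le> B / fact K"
    by (simp add: zeta_remainder_def norm_minus_commute)
  also have "\<dots> \<le> B / 1"
    by (intro divide_left_mono) (auto simp: B_def intro!: mult_nonneg_nonneg prod_nonneg)
  finally show ?thesis by (simp add: B_def)
qed

lemma holomorphic_zeta_remainder: "zeta_remainder K n holomorphic_on S"
proof -
  have "zeta_remainder K n = (\<lambda>s. (\<Sum>k\<le>K. ((\<Prod>i<k. 1 - s - of_nat i) / fact k) * of_nat (Suc n) powr (1 - s - of_nat k))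
       - of_nat (Suc (Suc n)) powr (1 - s))"
    by (simp add: fun_eq_iff zeta_remainder_def gbinomial_prod_rev atLeast0LessThan)
  thus ?thesis by (auto intro!: holomorphic_intros)
qed

lemma summable_Suc_powr: "c > 1 \<Longrightarrow> summable (\<lambda>n. real (Suc n) powr - c)"
  by (subst summable_Suc_iff[of "\<lambda>n. real n powr - c"]) (simp add: summable_real_powr_iff)

lemma zeta_remainder_local_bound:
  assumes "Re s > 1 - real K"
  shows "\<exists>d h. 0 < d \<and> summable h \<and> (\<forall>n. \<forall>y\<in>ball s d. norm (zeta_remainder K n y) \<le> h n)"
proof -
  define d where "d = (Re s - (1 - real K)) / 2"
  define C where "C = (\<Prod>j\<le>K. 1 + (norm s + d) + real j)"
  have d: "d > 0" using assms by (simp add: d_def)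
  have "norm (zeta_remainder K n y) \<le> C * real (Suc n) powr - (1 + d)" if y: "y \<in> ball s d" for n y
  proof -
    have "\<bar>Re s - Re y\<bar> \<le> dist s y"
      using abs_Re_le_cmod[of "s - y"] by (simp add: dist_norm)
    with y have Re: "Re y + real K > 1 + d" by (simp add: d_def field_simps)
    have ny: "norm y \<le> norm s + d"
      using y norm_triangle_ineq2[of y s] by (simp add: dist_norm norm_minus_commute)
    have "norm (zeta_remainder K n y)
           \<le> (\<Prod>j\<le>K. norm (1 - y - of_nat j)) * real (Suc n) powr (- Re y - real K)"
      by (rule norm_zeta_remainder_le) (use Re d in auto)
    also have "\<dots> \<le> C * real (Suc n) powr - (1 + d)"
    proof (intro mult_mono powr_mono)
      show "(\<Prod>j\<le>K. norm (1 - y - of_nat j)) \<le> C" unfolding C_def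
      proof (intro prod_mono conjI)
        fix j
        have "norm (1 - y - of_nat j) \<le> norm (1 :: complex) + norm y + norm (of_nat j :: complex)"
          by (meson add_mono norm_triangle_ineq4 order.trans order_refl)
        thus "norm (1 - y - of_nat j) \<le> 1 + (norm s + d) + real j" using ny by simp
      qed auto
      show "0 \<le> C" unfolding C_def using d by (intro prod_nonneg) auto
    qed (use Re in auto)
    finally show ?thesis .
  qed
  moreover have "summable (\<lambda>n. C * real (Suc n) powr - (1 + d))"
    by (intro summable_mult summable_Suc_powr) (use d in auto)
  ultimately show ?thesis using d by blast
qed

lemma holomorphic_suminf_zeta_remainder:
  "(\<lambda>s. \<Sum>n. zeta_remainder K n s) holomorphic_on {s. Re s > 1 - real K}"
proof (rule holomorphic_on_suminf_local)
  show "open {s. Re s > 1 - real K}" by (rule open_halfspace_Re_gt)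
  fix s assume "s \<in> {s. Re s > 1 - real K}"
  thus "\<exists>d h. 0 < d \<and> summable h \<and>
          (\<forall>n. \<forall>y\<in>ball s d \<inter> {s. Re s > 1 - real K}. norm (zeta_remainder K n y) \<le> h n)"
    using zeta_remainder_local_bound[of K s] by (metis IntD1 mem_Collect_eq)
qed (rule holomorphic_zeta_remainder)

definition zeta_series :: "complex \<Rightarrow> complex" where
  "zeta_series s = (\<Sum>n. 1 / of_nat (Suc n) powr s)"

lemma norm_zeta_term: "norm (1 / of_nat (Suc n) powr s) = real (Suc n) powr - Re s"
proof -
  have "norm (of_nat (Suc n) powr s) = real (Suc n) powr Re s"
    by (subst norm_powr_real_powr) auto
  thus ?thesis by (simp add: norm_divide powr_minus_divide)
qed

lemma sums_zeta_series:
  assumes "Re s > 1"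
  shows "(\<lambda>n. 1 / of_nat (Suc n) powr s) sums zeta_series s"
proof -
  have "summable (\<lambda>n. norm (1 / of_nat (Suc n) powr s))"
    unfolding norm_zeta_term using assms by (rule summable_Suc_powr)
  from summable_norm_cancel[OF this] show ?thesis
    unfolding zeta_series_def by (rule summable_sums)
qed

lemma holomorphic_zeta_series: "zeta_series holomorphic_on {s. Re s > 1}"
  unfolding zeta_series_def
proof (rule holomorphic_on_suminf_local)
  show "open {s. Re s > 1}" by (rule open_halfspace_Re_gt)
  show "(\<lambda>s. 1 / of_nat (Suc n) powr s) holomorphic_on {s. Re s > 1}" for n
    by (auto intro!: holomorphic_intros)
  fix s :: complex assume s: "s \<in> {s. Re s > 1}"
  define d where "d = (Re s - 1) / 2"
  have d: "d > 0" using s by (simp add: d_def)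
  have "norm (1 / of_nat (Suc n) powr y) \<le> real (Suc n) powr - (1 + d)" if y: "y \<in> ball s d" for n y
  proof -
    have "\<bar>Re s - Re y\<bar> \<le> dist s y"
      using abs_Re_le_cmod[of "s - y"] by (simp add: dist_norm)
    with y have "Re y > 1 + d" by (simp add: d_def field_simps)
    thus ?thesis unfolding norm_zeta_term by (intro powr_mono) auto
  qed
  moreover have "summable (\<lambda>n. real (Suc n) powr - (1 + d))"
    by (rule summable_Suc_powr) (use d in auto)
  ultimately show "\<exists>d h. 0 < d \<and> summable h \<and>
          (\<forall>n. \<forall>y\<in>ball s d \<inter> {s. Re s > 1}. norm (1 / of_nat (Suc n) powr y) \<le> h n)"
    using d by (metis IntD1)
qed

text \<open>
  Summing the Taylor expansion of $(n+1)^{1-s} - n^{1-s}$ over $n$ expresses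
  $(s-1)\zeta(s)$ through the values $\zeta(s+1), \ldots, \zeta(s+K-1)$.
\<close>

lemma zeta_series_recurrence:
  assumes s: "Re s > 1" and K: "K \<ge> 1"
  shows "(s - 1) * zeta_series s =
     1 - (\<Sum>n. zeta_remainder K n s)
       + (\<Sum>k=2..K. ((1 - s) gchoose k) * zeta_series (s + of_nat k - 1))"
proof -
  define b where "b = (\<lambda>n. of_nat (Suc n) powr (1 - s) :: complex)"
  have "b \<longlonglongrightarrow> 0"
  proof (rule tendsto_norm_zero_cancel)
    have "(\<lambda>n. norm (b n)) = (\<lambda>n. real (Suc n) powr (1 - Re s))"
      by (auto simp: b_def fun_eq_iff norm_powr_real_powr)
    moreover have "(\<lambda>n. real (Suc n) powr (1 - Re s)) \<longlonglongrightarrow> 0"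
      using s by (intro tendsto_neg_powr filterlim_compose[OF filterlim_real_sequentially filterlim_Suc]) auto
    ultimately show "(\<lambda>n. norm (b n)) \<longlonglongrightarrow> 0" by simp
  qed
  from telescope_sums'[OF this] have 1: "(\<lambda>n. b n - b (Suc n)) sums 1"
    by (simp add: b_def)
  have 2: "(\<lambda>n. \<Sum>k=1..K. ((1 - s) gchoose k) * of_nat (Suc n) powr (1 - s - of_nat k))
      sums (\<Sum>k=1..K. ((1 - s) gchoose k) * zeta_series (s + of_nat k - 1))"
  proof (intro sums_sum sums_mult)
    fix k assume k: "k \<in> {1..K}"
    have "(\<lambda>n. 1 / of_nat (Suc n) powr (s + of_nat k - 1)) sums zeta_series (s + of_nat k - 1)"
      by (rule sums_zeta_series) (use s k in auto)
    also have "(\<lambda>n. 1 / of_nat (Suc n) powr (s + of_nat k - 1))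
        = (\<lambda>n. of_nat (Suc n) powr (1 - s - of_nat k) :: complex)"
      by (subst powr_minus_divide[symmetric]) (simp add: algebra_simps)
    finally show "(\<lambda>n. of_nat (Suc n) powr (1 - s - of_nat k)) sums zeta_series (s + of_nat k - 1)" .
  qed
  have "{..K} = insert 0 {1..K}" by auto
  hence eq: "zeta_remainder K n s =
      (b n - b (Suc n)) + (\<Sum>k=1..K. ((1 - s) gchoose k) * of_nat (Suc n) powr (1 - s - of_nat k))" for n
    by (simp add: zeta_remainder_def b_def)
  have "(\<lambda>n. zeta_remainder K n s) sums
     (1 + (\<Sum>k=1..K. ((1 - s) gchoose k) * zeta_series (s + of_nat k - 1)))"
    unfolding eq by (rule sums_add[OF 1 2])
  hence "(\<Sum>n. zeta_remainder K n s) = 1 + (\<Sum>k=1..K. ((1 - s) gchoose k) * zeta_series (s + of_nat k - 1))"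
    by (simp add: sums_iff)
  also have "{1..K} = insert 1 {2..K}" using K by auto
  finally show ?thesis by (simp add: algebra_simps)
qed

lemma zeta_series_halfplane_continuation:
  "\<exists>g. g holomorphic_on {s. Re s > 1 - real m} \<and> (\<forall>s. Re s > 1 \<longrightarrow> g s = (s - 1) * zeta_series s)"
proof (induction m)
  case 0
  show ?case
    by (rule exI[of _ "\<lambda>s. (s - 1) * zeta_series s"])
       (auto intro!: holomorphic_intros holomorphic_zeta_series)
next
  case (Suc m)
  then obtain g where g: "g holomorphic_on {s. Re s > 1 - real m}"
    "\<And>s. Re s > 1 \<Longrightarrow> g s = (s - 1) * zeta_series s" by blast
  define K where "K = m + 2"
  define p where "p = (\<lambda>k s. - (\<Prod>i<k - 1. 1 - s - of_nat i) / fact k :: complex)"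
  define G where "G = (\<lambda>s. 1 - (\<Sum>n. zeta_remainder K n s) + (\<Sum>k=2..K. p k s * g (s + of_nat k - 1)))"
  have "G holomorphic_on {s. Re s > 1 - real (Suc m)}"
    unfolding G_def
  proof (intro holomorphic_intros)
    show "(\<lambda>s. \<Sum>n. zeta_remainder K n s) holomorphic_on {s. Re s > 1 - real (Suc m)}"
      by (rule holomorphic_on_subset[OF holomorphic_suminf_zeta_remainder]) (auto simp: K_def)
    show "p k holomorphic_on {s. Re s > 1 - real (Suc m)}" for k
      unfolding p_def by (auto intro!: holomorphic_intros)
    fix k assume k: "k \<in> {2..K}"
    have "g \<circ> (\<lambda>s. s + of_nat k - 1) holomorphic_on {s. Re s > 1 - real (Suc m)}"
      by (rule holomorphic_on_compose_gen[OF _ g(1)]) (use k in \<open>auto intro!: holomorphic_intros\<close>)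
    thus "(\<lambda>s. g (s + of_nat k - 1)) holomorphic_on {s. Re s > 1 - real (Suc m)}"
      by (simp add: o_def)
  qed
  moreover have "G s = (s - 1) * zeta_series s" if s: "Re s > 1" for s
  proof -
    have "p k s * g (s + of_nat k - 1) = ((1 - s) gchoose k) * zeta_series (s + of_nat k - 1)"
      if k: "k \<in> {2..K}" for k
    proof -
      obtain l where l: "k = Suc l" using k by (cases k) auto
      have "g (s + of_nat k - 1) = (s + of_nat k - 1 - 1) * zeta_series (s + of_nat k - 1)"
        by (rule g(2)) (use s k in auto)
      hence g_val: "g (s + of_nat k - 1) = (s + of_nat l - 1) * zeta_series (s + of_nat k - 1)"
        by (simp add: l)
      have "(1 - s) gchoose k = - ((\<Prod>i<l. 1 - s - of_nat i) / fact k) * (s + of_nat l - 1)"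
        unfolding gbinomial_prod_rev atLeast0LessThan l prod.lessThan_Suc
        by (simp add: algebra_simps add_divide_distrib diff_divide_distrib)
      thus ?thesis unfolding g_val by (simp add: p_def l)
    qed
    thus ?thesis
      unfolding G_def by (subst zeta_series_recurrence[OF s, of K]) (auto simp: K_def)
  qed
  ultimately show ?case by blast
qed

lemma zeta_series_continuation:
  "\<exists>f. f holomorphic_on (- {1}) \<and>
       (\<forall>s. Re s > 1 \<longrightarrow> (\<lambda>n. 1 / of_nat (Suc n) powr s) sums f s)"
proof -
  from zeta_series_halfplane_continuation obtain g where
    g: "\<And>m. g m holomorphic_on {s. Re s > 1 - real m}"
    and g_eq: "\<And>m s. Re s > 1 \<Longrightarrow> g m s = (s - 1) * zeta_series s" by metis
  have agree: "g m s = g m' s" if "m \<le> m'" "Re s > 1 - real m" for m m' s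
  proof (rule analytic_continuation_open[of "{s. Re s > 1}" "{s. Re s > 1 - real m}" "g m" "g m'"])
    show "connected {s. Re s > 1 - real m}" by (simp add: convex_connected convex_halfspace_Re_gt)
    show "{s. Re s > 1} \<noteq> {}" by (auto intro!: exI[of _ 2])
    show "g m' holomorphic_on {s. Re s > 1 - real m}"
      by (rule holomorphic_on_subset[OF g]) (use that in auto)
  qed (use that g g_eq in \<open>auto simp: open_halfspace_Re_gt\<close>)
  define G where "G = (\<lambda>s. g (nat \<lceil>2 - Re s\<rceil>) s)"
  have G_eq: "G s = g m s" if "Re s > 1 - real m" for m s
  proof -
    have "Re s > 1 - real (nat \<lceil>2 - Re s\<rceil>)" by linarith
    with that show ?thesis unfolding G_def
      using agree[of m "nat \<lceil>2 - Re s\<rceil>" s] agree[of "nat \<lceil>2 - Re s\<rceil>" m s] by (metis nle_le)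
  qed
  have "G holomorphic_on (\<Union>m. {s. Re s > 1 - real m})"
  proof (rule holomorphic_on_UN_open)
    show "G holomorphic_on {s. Re s > 1 - real m}" for m
      using g[of m] by (rule holomorphic_transform) (use G_eq in auto)
  qed (rule open_halfspace_Re_gt)
  hence "G holomorphic_on - {1}"
  proof (rule holomorphic_on_subset)
    show "- {1} \<subseteq> (\<Union>m. {s. Re s > 1 - real m})"
    proof
      fix s :: complex
      have "Re s > 1 - real (nat \<lceil>2 - Re s\<rceil>)" by linarith
      thus "s \<in> (\<Union>m. {s. Re s > 1 - real m})" by blast
    qed
  qed
  hence "(\<lambda>s. G s / (s - 1)) holomorphic_on - {1}"
    by (auto intro!: holomorphic_intros)
  moreover have "G s / (s - 1) = zeta_series s" if "Re s > 1" for s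
    using G_eq[of 0 s] g_eq[of s 0] that by auto
  ultimately show ?thesis
    using sums_zeta_series by (intro exI[of _ "\<lambda>s. G s / (s - 1)"]) auto
qed


subsection \<open>The Riemann zeta function\<close>

text \<open>
  The analytic continuation of the zeta series to the plane without $1$; the value at $1$
  is unspecified.
\<close>

definition zeta :: "complex \<Rightarrow> complex" where
  "zeta = (SOME f. f holomorphic_on (- {1}) \<and>
             (\<forall>s. Re s > 1 \<longrightarrow> (\<lambda>n. 1 / of_nat (Suc n) powr s) sums f s))"

lemma holomorphic_zeta: "zeta holomorphic_on (- {1})"
  and zeta_sums: "Re s > 1 \<Longrightarrow> (\<lambda>n. 1 / of_nat (Suc n) powr s) sums zeta s"
  using someI_ex[OF zeta_series_continuation] unfolding zeta_def by blast+

lemma zeta_unique: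
  assumes "f holomorphic_on (- {1})"
    and "\<And>s. Re s > 1 \<Longrightarrow> (\<lambda>n. 1 / of_nat (Suc n) powr s) sums f s"
    and "s \<noteq> 1"
  shows "f s = zeta s"
proof (rule analytic_continuation_open[of "{s. Re s > 1}" "- {1}" f zeta])
  show "connected (- {1 :: complex})" by (rule connected_punctured_universe) simp
  show "{s. Re s > 1} \<noteq> {}" by (auto intro!: exI[of _ 2])
  show "f z = zeta z" if "z \<in> {s. Re s > 1}" for z
    using that assms(2) zeta_sums sums_unique2 by blast
qed (use assms holomorphic_zeta in \<open>auto simp: open_halfspace_Re_gt\<close>)

definition Riemann_hypothesis :: bool where
  "Riemann_hypothesis \<longleftrightarrow> (\<forall>s. zeta s = 0 \<and> 0 < Re s \<and> Re s < 1 \<longrightarrow> Re s = 1 / 2)"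


subsection \<open>The Riemann-Siegel theta function and Hardy's function\<close>

text \<open>
  The library function \<^const>\<open>ln_Gamma\<close> is holomorphic off the nonpositive reals and real on
  the positive reals, so its imaginary part along $1/4 + it/2$ is the continuous branch that
  vanishes at $t = 0$.
\<close>

definition riemann_siegel_theta :: "real \<Rightarrow> real" where
  "riemann_siegel_theta t = Im (ln_Gamma (1 / 4 + \<i> * of_real t / 2)) - t / 2 * ln pi"

lemma riemann_siegel_theta_0: "riemann_siegel_theta 0 = 0"
  using ln_Gamma_complex_of_real[of "1 / 4"] by (simp add: riemann_siegel_theta_def)

lemma continuous_riemann_siegel_theta: "continuous_on UNIV riemann_siegel_theta"
proof -
  have "isCont (\<lambda>t. ln_Gamma (1 / 4 + \<i> * of_real t / 2)) t" for t :: real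
    by (intro continuous_intros) (auto simp: complex_nonpos_Reals_iff)
  thus ?thesis
    unfolding riemann_siegel_theta_def
    by (intro continuous_intros continuous_at_imp_continuous_on ballI) auto
qed

definition hardy_Z :: "real \<Rightarrow> complex" where
  "hardy_Z t = exp (\<i> * of_real (riemann_siegel_theta t)) * zeta (1 / 2 + \<i> * of_real t)"

definition neighboring_ordinates :: "real \<Rightarrow> real \<Rightarrow> bool" where
  "neighboring_ordinates \<gamma>\<^sub>1 \<gamma>\<^sub>2 \<longleftrightarrow>
     \<gamma>\<^sub>1 < \<gamma>\<^sub>2 \<and> zeta (1 / 2 + \<i> * of_real \<gamma>\<^sub>1) = 0 \<and> zeta (1 / 2 + \<i> * of_real \<gamma>\<^sub>2) = 0 \<and>
     (\<forall>\<gamma>. \<gamma>\<^sub>1 < \<gamma> \<and> \<gamma> < \<gamma>\<^sub>2 \<longrightarrow> zeta (1 / 2 + \<i> * of_real \<gamma>) \<noteq> 0)"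

end

theory Submission
  imports Defs "HOL-Computational_Algebra.Primes" "HOL-Real_Asymp.Real_Asymp"
begin

text \<open>
  Since $Z'(t) = 0$, we have $\zeta'(s) = -w \zeta(s)$ at $s = 1/2 + it$ with the real number
  $w = \vartheta'(t)$. Expanding $\zeta$ to second order at $s$ and evaluating at a zero
  $1/2 + i\gamma$ gives $|\zeta(s)| \, |1 - i w (\gamma - t)| \le K (\gamma - t)^2$, where $K$ bounds $\zeta''$,
  and the second factor on the left is at least $1$, so no information on $w$ is needed. The Riemann
  hypothesis implies the Lindeloef hypothesis, hence $K = O(t^\epsilon)$ and
  $|\gamma - t| > t^{-\alpha/2 - \epsilon}$.

  To replace $t$ by the lower ordinate one needs that the ordinates of consecutive zeros
  are of comparable size. If $\zeta$ had no zeros with ordinates in $[T, 4T]$, then $\log\zeta$ would be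
  holomorphic there, so $\zeta(1/4 + it)$ would be $O(t^\epsilon)$ by the same argument as for
  Lindeloef. This contradicts the mean square lower bound obtained by pairing $\zeta$ with a
  short Dirichlet polynomial. The functional equation is never used.
\<close>

subsection \<open>Auxiliary results from complex analysis\<close>

text \<open>The quadratic dependence on the distance makes the exponents close. If a zero lay within
  5 t^(-\<alpha>) of t, then |\<zeta>| at t would be O(t^(\<epsilon> - 2\<alpha>)), which
  contradicts the assumed t^(-\<alpha>) once \<epsilon> < \<alpha>; the choice is \<epsilon> =
  \<alpha>/2. The slack t^(\<alpha>/2) absorbs every constant, among them the 5 lost in passing to
  the lower ordinate. That passage is a real obstacle: the bound to be proved grows as the lower
  ordinate shrinks, so a lower ordinate far below t has to be excluded. The mean square is taken on
  Re s = 1/4 because the squared coefficients n^(-1/2) of a Dirichlet polynomial of length N sum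
  there to order sqrt N. A length that is a small power of T then forces power growth, which no
  bound O(T^\<epsilon>) survives; to the right of 1/2 the corresponding sums stay bounded. Hence log
  \<zeta> must be controlled to the left of the critical line as well, and the zero-free estimate is
  proved for a variable abscissa.\<close>

text \<open>
  Applying the maximum principle to $f(z) / (z - c)^N$ replaces the three circles theorem: the best
  choice of $N$ recovers it up to rounding, and no fractional powers are needed.
\<close>

lemma maximum_modulus_annulus:
  fixes f :: "complex \<Rightarrow> complex"
  assumes f: "f holomorphic_on ball c R" and r: "0 < r1" "r1 \<le> r2" "r2 \<le> r3" "r3 < R"
    and M1: "\<And>z. dist c z \<le> r1 \<Longrightarrow> norm (f z) \<le> M1"
    and M3: "\<And>z. dist c z \<le> r3 \<Longrightarrow> norm (f z) \<le> M3"
    and z: "dist c z \<le> r2"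
  shows "norm (f z) \<le> M1 * (r2 / r1) ^ N + M3 * (r2 / r3) ^ N"
proof -
  have pos: "0 \<le> M1" "0 \<le> M3"
    using M1[of c] M3[of c] r by (auto intro: order_trans[OF norm_ge_zero])
  have ge1: "M1 \<le> M1 * (r2 / r1) ^ N"
    using r pos by (simp add: mult_le_cancel_left1 one_le_power)
  have p1: "0 \<le> M1 * (r2 / r1) ^ N" and p3: "0 \<le> M3 * (r2 / r3) ^ N"
    using pos r by auto
  show ?thesis
  proof (cases "dist c z \<le> r1")
    case True
    with M1[of z] ge1 p3 show ?thesis by linarith
  next
    case False
    hence z': "r1 < dist c z" "0 < dist c z" using r by auto
    define S where "S = cball c r3 - ball c r1"
    define B where "B = M1 / r1 ^ N + M3 / r3 ^ N"
    have fr: "frontier S \<subseteq> sphere c r1 \<union> sphere c r3"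
    proof -
      have "frontier S \<subseteq> frontier (cball c r3) \<union> frontier (ball c r1)"
        unfolding S_def using frontier_Int_subset[of "cball c r3" "- ball c r1"]
        by (auto simp: Diff_eq frontier_complement)
      thus ?thesis using r by auto
    qed
    have sub: "S \<subseteq> ball c R" "closure S = S"
      using r by (auto simp: S_def intro!: closure_closed)
    have hol: "(\<lambda>w. f w / (w - c) ^ N) holomorphic_on S"
      using holomorphic_on_subset[OF f sub(1)] r by (intro holomorphic_intros) (auto simp: S_def)
    have "norm (f z / (z - c) ^ N) \<le> B"
    proof (rule maximum_modulus_frontier[of "\<lambda>w. f w / (w - c) ^ N" S])
      show "(\<lambda>w. f w / (w - c) ^ N) holomorphic_on interior S"
        using hol holomorphic_on_subset interior_subset by blast
      show "continuous_on (closure S) (\<lambda>w. f w / (w - c) ^ N)"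
        using hol sub(2) holomorphic_on_imp_continuous_on by simp
      show "bounded S" unfolding S_def by (rule bounded_diff) simp
      show "z \<in> S" using z z' r by (auto simp: S_def)
      fix w assume "w \<in> frontier S"
      with fr have "dist c w = r1 \<or> dist c w = r3" by auto
      thus "norm (f w / (w - c) ^ N) \<le> B"
      proof
        assume w: "dist c w = r1"
        have "norm (f w / (w - c) ^ N) = norm (f w) / r1 ^ N"
          using w by (simp add: norm_divide norm_power dist_norm norm_minus_commute)
        also have "\<dots> \<le> M1 / r1 ^ N" using M1[of w] w r by (intro divide_right_mono) auto
        also have "\<dots> \<le> B" using pos r by (simp add: B_def)
        finally show ?thesis .
      next
        assume w: "dist c w = r3"
        have "norm (f w / (w - c) ^ N) = norm (f w) / r3 ^ N"
          using w by (simp add: norm_divide norm_power dist_norm norm_minus_commute)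
        also have "\<dots> \<le> M3 / r3 ^ N" using M3[of w] w r by (intro divide_right_mono) auto
        also have "\<dots> \<le> B" using pos r by (simp add: B_def)
        finally show ?thesis .
      qed
    qed
    hence "norm (f z) \<le> B * dist c z ^ N"
      using z' by (simp add: norm_divide norm_power dist_norm norm_minus_commute field_simps)
    also have "\<dots> \<le> B * r2 ^ N"
      using z z' pos r by (intro mult_left_mono power_mono) (auto simp: B_def)
    also have "\<dots> = M1 * (r2 / r1) ^ N + M3 * (r2 / r3) ^ N"
      by (simp add: B_def power_divide algebra_simps)
    finally show ?thesis .
  qed
qed

text \<open>The map G -> G / (2A - G) takes the half-plane Re G < A into the unit disc and fixes 0,
  so the Schwarz lemma applies after rescaling; solving back for G costs the factor 1 / (R -
  r).\<close>

lemma Borel_Caratheodory: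
  fixes g :: "complex \<Rightarrow> complex"
  assumes g: "g holomorphic_on ball c R" and "0 < R" and A: "\<And>z. z \<in> ball c R \<Longrightarrow> Re (g z - g c) < A"
    and z: "dist c z \<le> r" "r < R"
  shows "norm (g z - g c) \<le> 2 * A * r / (R - r)"
proof -
  define G where "G = (\<lambda>w. g (c + of_real R * w) - g c)"
  define h where "h = (\<lambda>w. G w / (2 * of_real A - G w))"
  have A0: "0 < A" using A[of c] \<open>0 < R\<close> by simp
  have in_ball: "c + of_real R * w \<in> ball c R" if "norm w < 1" for w :: complex
    using that \<open>0 < R\<close> by (simp add: dist_norm norm_mult)
  have ReG: "Re (G w) < A" if "norm w < 1" for w
    using A[OF in_ball[OF that]] by (simp add: G_def)
  have nz: "2 * of_real A - G w \<noteq> 0" if "norm w < 1" for w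
  proof
    assume "2 * of_real A - G w = 0"
    hence "Re (G w) = 2 * A" by (simp add: complex_eq_iff)
    with ReG[OF that] A0 show False by simp
  qed
  have "g \<circ> (\<lambda>w. c + of_real R * w) holomorphic_on ball 0 1"
    by (rule holomorphic_on_compose_gen[OF _ g]) (use in_ball in \<open>auto intro!: holomorphic_intros\<close>)
  hence holG: "G holomorphic_on ball 0 1"
    unfolding G_def o_def by (intro holomorphic_intros)
  have Schw: "norm (h w) \<le> norm w" if w: "norm w < 1" for w
  proof (rule Schwarz_Lemma(1)[OF _ _ _ w])
    show "h holomorphic_on ball 0 1"
      unfolding h_def using nz by (intro holomorphic_intros holG) auto
    show "h 0 = 0" by (simp add: h_def G_def)
    show "norm (h u) < 1" if u: "norm u < 1" for u
    proof -
      have "(norm (G u))\<^sup>2 < (norm (2 * of_real A - G u))\<^sup>2"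
      proof -
        have "0 < 4 * A * (A - Re (G u))" using ReG[OF u] A0 by simp
        thus ?thesis unfolding cmod_power2 by (simp add: power2_eq_square algebra_simps)
      qed
      hence "norm (G u) < norm (2 * of_real A - G u)" by (rule power2_less_imp_less) simp
      thus ?thesis using nz[OF u] by (simp add: h_def norm_divide)
    qed
  qed
  define w where "w = (z - c) / of_real R"
  have nw: "norm w = dist c z / R" using \<open>0 < R\<close>
    by (simp add: w_def norm_divide dist_norm norm_minus_commute)
  have w1: "norm w < 1" using z \<open>0 < R\<close> by (simp add: nw)
  have Gw: "G w = g z - g c" using \<open>0 < R\<close> by (simp add: G_def w_def)
  have "norm (G w) \<le> norm w * norm (2 * of_real A - G w)"
    using Schw[OF w1] nz[OF w1] by (simp add: h_def norm_divide divide_le_eq)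
  also have "\<dots> \<le> norm w * (2 * A + norm (G w))"
    using norm_triangle_ineq4[of "2 * of_real A" "G w"] A0 by (intro mult_left_mono) auto
  finally have *: "norm (G w) * (1 - norm w) \<le> 2 * A * norm w" by (simp add: algebra_simps)
  have "norm (G w) * (R - r) \<le> norm (G w) * (R * (1 - norm w))"
    using z \<open>0 < R\<close> by (intro mult_left_mono) (auto simp: nw field_simps)
  also have "\<dots> \<le> R * (2 * A * norm w)" using * \<open>0 < R\<close> by (simp add: mult.left_commute)
  also have "\<dots> \<le> 2 * A * r" using z A0 \<open>0 < R\<close> by (simp add: nw)
  finally show ?thesis using z Gw by (simp add: pos_le_divide_eq)
qed

text \<open>A primitive g of f'/f exists on the convex disc, and f exp(-g) then has derivative 0.
  Pinning g at the centre to the principal logarithm makes g c boundable, so that estimates of g - g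
  c become estimates of g.\<close>

lemma holomorphic_log_ball:
  assumes "f holomorphic_on ball c R" "0 < R" "\<And>z. z \<in> ball c R \<Longrightarrow> f z \<noteq> 0"
  obtains g where "g holomorphic_on ball c R" "\<And>z. z \<in> ball c R \<Longrightarrow> f z = exp (g z)" "g c = Ln (f c)"
proof -
  have "(\<lambda>z. deriv f z / f z) holomorphic_on ball c R"
    using assms by (intro holomorphic_intros) auto
  then obtain h where h: "\<And>x. x \<in> ball c R \<Longrightarrow> (h has_field_derivative deriv f x / f x) (at x within ball c R)"
    using holomorphic_convex_primitive'[of "ball c R"] by blast
  define g where "g = (\<lambda>z. h z - h c + Ln (f c))"
  have g: "(g has_field_derivative deriv f x / f x) (at x within ball c R)" if "x \<in> ball c R" for x
    unfolding g_def using h[OF that] by (auto intro!: derivative_eq_intros)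
  have df: "(f has_field_derivative deriv f x) (at x within ball c R)" if "x \<in> ball c R" for x
    using holomorphic_derivI[OF assms(1) open_ball that] DERIV_subset by blast
  have "\<exists>k. \<forall>x\<in>ball c R. f x * exp (- g x) = k"
  proof (rule has_field_derivative_zero_constant)
    show "((\<lambda>x. f x * exp (- g x)) has_field_derivative 0) (at x within ball c R)" if "x \<in> ball c R" for x
      using assms(3)[OF that]
      by (auto intro!: derivative_eq_intros df[OF that] g[OF that] simp: field_simps)
  qed auto
  then obtain k where k: "\<And>x. x \<in> ball c R \<Longrightarrow> f x * exp (- g x) = k" by blast
  have "k = 1" using k[of c] assms(2,3) by (auto simp: g_def exp_minus)
  show ?thesis
  proof
    show "g holomorphic_on ball c R" using g unfolding holomorphic_on_def field_differentiable_def by blast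
    show "g c = Ln (f c)" by (simp add: g_def)
    show "f z = exp (g z)" if "z \<in> ball c R" for z
      using k[OF that] \<open>k = 1\<close> by (simp add: exp_minus field_simps)
  qed
qed

subsection \<open>Bounds for the zeta function\<close>

text \<open>For K = 1 the sum over k = 2..K in \<open>zeta_series_recurrence\<close> is empty, and
  the remainder series is holomorphic for Re s > 0, so the identity extends there by analytic
  continuation.\<close>

lemma zeta_eq_remainder_sum:
  assumes "Re s > 0" "s \<noteq> 1"
  shows "(s - 1) * zeta s = 1 - (\<Sum>n. zeta_remainder 1 n s)"
proof (rule analytic_continuation_open[of "{s. Re s > 1}" "{s. Re s > 0} - {1}"
      "\<lambda>s. (s - 1) * zeta s" "\<lambda>s. 1 - (\<Sum>n. zeta_remainder 1 n s)"])
  show "open ({s. Re s > 0} - {1})" by (intro open_Diff open_halfspace_Re_gt) auto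
  show "connected ({s. Re s > 0} - {1 :: complex})"
    by (rule connected_open_delete)
       (auto simp: open_halfspace_Re_gt convex_connected convex_halfspace_Re_gt)
  show "{s. Re s > 1} \<noteq> {}" by (auto intro!: exI[of _ 2])
  show "(\<lambda>s. (s - 1) * zeta s) holomorphic_on {s. Re s > 0} - {1}"
    by (intro holomorphic_intros holomorphic_on_subset[OF holomorphic_zeta]) auto
  show "(\<lambda>s. 1 - (\<Sum>n. zeta_remainder 1 n s)) holomorphic_on {s. Re s > 0} - {1}"
    using holomorphic_suminf_zeta_remainder[of 1]
    by (intro holomorphic_intros) (auto elim: holomorphic_on_subset)
  fix s :: complex assume "s \<in> {s. Re s > 1}"
  hence s: "Re s > 1" by simp
  have "zeta s = zeta_series s" using zeta_sums[OF s] sums_zeta_series[OF s] sums_unique2 by blast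
  thus "(s - 1) * zeta s = 1 - (\<Sum>n. zeta_remainder 1 n s)"
    using zeta_series_recurrence[OF s, of 1] by simp
qed (use assms in \<open>auto simp: open_halfspace_Re_gt\<close>)

text \<open>The abscissa 1/8 gives the remainder terms the uniform exponent -9/8. Keeping the factor
  s - 1 serves two purposes: divided out for |Im s| >= 1 it yields linear growth, and near s = 1 it
  measures the pole.\<close>

lemma zeta_pole_bound:
  obtains C where "C > 0" "\<And>s. Re s \<ge> 1/8 \<Longrightarrow> s \<noteq> 1 \<Longrightarrow> norm ((s - 1) * zeta s) \<le> 1 + C * norm s * norm (s - 1)"
proof
  define C where "C = (\<Sum>n. real (Suc n) powr - (9/8))"
  have summ: "summable (\<lambda>n. real (Suc n) powr - (9/8))" by (rule summable_Suc_powr) simp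
  show "C > 0" unfolding C_def by (rule suminf_pos[OF summ]) simp
  fix s :: complex assume s: "Re s \<ge> 1/8" "s \<noteq> 1"
  have le: "norm (zeta_remainder 1 n s) \<le> norm s * norm (s - 1) * real (Suc n) powr - (9/8)" for n
  proof -
    have "norm (zeta_remainder 1 n s)
            \<le> (\<Prod>j\<le>1. norm (1 - s - of_nat j)) * real (Suc n) powr (- Re s - real 1)"
      by (rule norm_zeta_remainder_le) (use s in auto)
    also have "(\<Prod>j\<le>1. norm (1 - s - of_nat j)) = norm s * norm (s - 1)"
      by (simp add: norm_minus_commute mult.commute)
    also have "norm s * norm (s - 1) * real (Suc n) powr (- Re s - real 1)
        \<le> norm s * norm (s - 1) * real (Suc n) powr - (9/8)"
      using s by (intro mult_left_mono powr_mono) auto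
    finally show ?thesis .
  qed
  have "norm (\<Sum>n. zeta_remainder 1 n s) \<le> (\<Sum>n. norm s * norm (s - 1) * real (Suc n) powr - (9/8))"
    by (intro norm_suminf_le le summable_mult summ)
  also have "\<dots> = C * norm s * norm (s - 1)"
    unfolding C_def by (subst suminf_mult[OF summ]) (simp add: mult_ac)
  finally have "norm (\<Sum>n. zeta_remainder 1 n s) \<le> C * norm s * norm (s - 1)" .
  moreover have "norm ((s - 1) * zeta s) \<le> norm (1 :: complex) + norm (\<Sum>n. zeta_remainder 1 n s)"
    using norm_triangle_ineq4[of 1 "\<Sum>n. zeta_remainder 1 n s"] s by (subst zeta_eq_remainder_sum) auto
  ultimately show "norm ((s - 1) * zeta s) \<le> 1 + C * norm s * norm (s - 1)" by simp
qed

lemma zeta_linear_bound: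
  obtains C where "C \<ge> 1" "\<And>s. Re s \<ge> 1/8 \<Longrightarrow> \<bar>Im s\<bar> \<ge> 1 \<Longrightarrow> norm (zeta s) \<le> C * norm s"
proof -
  obtain C where C: "C > 0" "\<And>s. Re s \<ge> 1/8 \<Longrightarrow> s \<noteq> 1 \<Longrightarrow> norm ((s - 1) * zeta s) \<le> 1 + C * norm s * norm (s - 1)"
    using zeta_pole_bound by blast
  show ?thesis
  proof (rule that[of "C + 1"])
    fix s :: complex assume s: "Re s \<ge> 1/8" "\<bar>Im s\<bar> \<ge> 1"
    have n: "norm (s - 1) \<ge> 1" "norm s \<ge> 1" using s abs_Im_le_cmod[of s] abs_Im_le_cmod[of "s - 1"] by auto
    have "norm (s - 1) * norm (zeta s) \<le> 1 + C * norm s * norm (s - 1)"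
      using C(2)[of s] s n by (cases "s = 1") (auto simp: norm_mult)
    moreover have "1 * 1 \<le> norm s * norm (s - 1)" using n by (intro mult_mono) auto
    ultimately have "norm (s - 1) * norm (zeta s) \<le> norm (s - 1) * ((C + 1) * norm s)"
      by (simp add: algebra_simps)
    thus "norm (zeta s) \<le> (C + 1) * norm s" using n by (subst (asm) mult_le_cancel_left) auto
  qed (use C in auto)
qed

text \<open>The series without its first term is dominated by that of 1/n^2. What matters is that
  the bound is below 1: it keeps \<zeta> in a disc around 1 that avoids 0.\<close>

lemma norm_zeta_minus_1_le:
  assumes "Re s \<ge> 2"
  shows "norm (zeta s - 1) \<le> pi\<^sup>2 / 6 - 1"
proof -
  have s1: "(\<lambda>n. 1 / of_nat (Suc n) powr s) sums zeta s" by (rule zeta_sums) (use assms in auto)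
  have "(\<lambda>n. 1 / of_nat (Suc (Suc n)) powr s) sums (zeta s - 1)"
    using s1 by (subst sums_Suc_iff) simp
  hence "norm (zeta s - 1) = norm (\<Sum>n. 1 / of_nat (Suc (Suc n)) powr s)" by (simp add: sums_iff)
  moreover have s2: "(\<lambda>n. 1 / (real (Suc n) + 1)\<^sup>2) sums (pi\<^sup>2 / 6 - 1)"
    using inverse_squares_sums by (subst sums_Suc_iff) (simp add: add.commute)
  moreover have "norm (\<Sum>n. 1 / of_nat (Suc (Suc n)) powr s) \<le> (\<Sum>n. 1 / (real (Suc n) + 1)\<^sup>2)"
  proof (rule norm_suminf_le)
    show "summable (\<lambda>n. 1 / (real (Suc n) + 1)\<^sup>2)" using s2 by (simp add: sums_iff)
    show "norm (1 / of_nat (Suc (Suc n)) powr s) \<le> 1 / (real (Suc n) + 1)\<^sup>2" for n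
    proof -
      have "norm (1 / of_nat (Suc (Suc n)) powr s) = real (Suc (Suc n)) powr - Re s"
        using norm_zeta_term[of "Suc n" s] .
      also have "\<dots> \<le> real (Suc (Suc n)) powr - 2" using assms by (intro powr_mono) auto
      also have "\<dots> = 1 / (real (Suc n) + 1)\<^sup>2"
        by (simp add: powr_minus powr_numeral field_simps)
      finally show ?thesis .
    qed
  qed
  ultimately show ?thesis by (simp add: sums_iff)
qed

lemma pi_squared_bound: "pi\<^sup>2 / 6 - 1 \<le> 7 / 10"
proof -
  have "pi\<^sup>2 \<le> (3.19)\<^sup>2" using pi_less_4 pi_approx by (intro power_mono) auto
  thus ?thesis by (simp add: power2_eq_square)
qed

subsection \<open>The Euler product and the line of real part one\<close>

text \<open>The multiples of p in A are exactly p times A and contribute f p times the whole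
  sum.\<close>

lemma infsum_sieve:
  fixes f :: "nat \<Rightarrow> complex"
  assumes mult: "\<And>n. n > 0 \<Longrightarrow> f (p * n) = f p * f n"
    and summ: "f summable_on A" and p: "p > 0"
    and A: "\<And>n. n \<in> A \<Longrightarrow> n > 0" "\<And>n. p * n \<in> A \<longleftrightarrow> n \<in> A"
  shows "(1 - f p) * infsum f A = infsum f {n\<in>A. \<not> p dvd n}"
proof -
  have eq: "A = {n\<in>A. \<not> p dvd n} \<union> (*) p ` A" (is "_ = ?B \<union> _")
    using A(2) by (auto elim!: dvdE)
  have inj: "inj_on ((*) p) A" using p by (auto simp: inj_on_def)
  have "infsum f ((*) p ` A) = infsum (f \<circ> (*) p) A" by (rule infsum_reindex[OF inj])
  also have "\<dots> = infsum (\<lambda>n. f p * f n) A" by (intro infsum_cong) (simp add: mult A)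
  also have "\<dots> = f p * infsum f A" by (rule infsum_cmult_right')
  finally have 1: "infsum f ((*) p ` A) = f p * infsum f A" .
  have "infsum f A = infsum f ?B + infsum f ((*) p ` A)"
    by (subst eq, rule infsum_Un_disjoint)
       (use A(2) in \<open>auto intro: summable_on_subset_banach[OF summ]\<close>)
  with 1 show ?thesis by (simp add: algebra_simps)
qed

lemma sieved_infsum:
  fixes f :: "nat \<Rightarrow> complex"
  assumes mult: "\<And>m n. m > 0 \<Longrightarrow> n > 0 \<Longrightarrow> f (m * n) = f m * f n"
    and summ: "f summable_on {0<..}"
  shows "(\<Prod>p | prime p \<and> p \<le> N. 1 - f p) * infsum f {0<..} =
           infsum f {n. n > 0 \<and> (\<forall>p. prime p \<and> p \<le> N \<longrightarrow> \<not> p dvd n)}"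
proof (induction N)
  case 0
  have 1: "{p::nat. prime p \<and> p \<le> 0} = {}" by auto
  have 2: "{n::nat. n > 0 \<and> (\<forall>p. prime p \<and> p \<le> 0 \<longrightarrow> \<not> p dvd n)} = {0<..}" by auto
  show ?case unfolding 1 2 by simp
next
  case (Suc N)
  let ?A = "\<lambda>N. {n. n > 0 \<and> (\<forall>p. prime p \<and> p \<le> N \<longrightarrow> \<not> p dvd n)}"
  show ?case
  proof (cases "prime (Suc N)")
    case False
    hence "prime p \<and> p \<le> Suc N \<longleftrightarrow> prime p \<and> p \<le> N" for p by (auto simp: le_Suc_eq)
    thus ?thesis using Suc by simp
  next
    case True
    have "{p. prime p \<and> p \<le> Suc N} = insert (Suc N) {p. prime p \<and> p \<le> N}"
      using True by (auto simp: le_Suc_eq)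
    hence "(\<Prod>p | prime p \<and> p \<le> Suc N. 1 - f p) * infsum f {0<..}
      = (1 - f (Suc N)) * infsum f (?A N)"
      using Suc.IH by (simp add: mult.assoc)
    also have "\<dots> = infsum f {n\<in>?A N. \<not> Suc N dvd n}"
    proof (rule infsum_sieve)
      show "f summable_on ?A N" by (rule summable_on_subset_banach[OF summ]) auto
      show "Suc N * n \<in> ?A N \<longleftrightarrow> n \<in> ?A N" for n
        using True by (auto simp: prime_dvd_mult_iff simp del: mult_Suc dest: primes_dvd_imp_eq)
      show "f (Suc N * n) = f (Suc N) * f n" if "n > 0" for n using that by (intro mult) auto
    qed auto
    also have "{n\<in>?A N. \<not> Suc N dvd n} = ?A (Suc N)"
      using True by (auto simp: le_Suc_eq)
    finally show ?thesis .
  qed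
qed

text \<open>Sieving by the primes up to N leaves n = 1 and otherwise only numbers n > N, whose terms
  are bounded by a tail of an absolutely convergent series. Keeping \<zeta> as a factor, instead of
  writing it as an infinite product, makes its nonvanishing immediate.\<close>

lemma Euler_product_tendsto:
  assumes s: "Re s > 1"
  shows "(\<lambda>N. (\<Prod>p | prime p \<and> p \<le> N. 1 - of_nat p powr - s) * zeta s) \<longlonglongrightarrow> 1"
proof -
  define f where "f = (\<lambda>n. of_nat n powr - s :: complex)"
  have fSuc: "f (Suc n) = 1 / of_nat (Suc n) powr s" for n
    unfolding f_def by (rule powr_minus_divide)
  have mult: "f (m * n) = f m * f n" for m n
    unfolding f_def of_nat_mult by (rule powr_times_real) auto
  have nsum: "summable (\<lambda>n. norm (f (Suc n)))"
    unfolding fSuc norm_zeta_term using s by (rule summable_Suc_powr)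
  have inj: "inj Suc" and ran: "range Suc = {0<..}" by (auto simp: image_iff gr0_conv_Suc)
  have "((\<lambda>n. f (Suc n)) has_sum zeta s) UNIV"
    by (rule norm_summable_imp_has_sum) (use nsum fSuc zeta_sums[OF s] in auto)
  hence hs: "(f has_sum zeta s) {0<..}"
    using has_sum_reindex[OF inj, of f] ran by (simp add: o_def)
  hence summ: "f summable_on {0<..}" by (auto simp: summable_on_def)
  have "((\<lambda>n. norm (f (Suc n))) has_sum (\<Sum>n. norm (f (Suc n)))) UNIV"
    by (rule norm_summable_imp_has_sum) (use nsum in auto)
  hence "((\<lambda>n. norm (f n)) has_sum (\<Sum>n. norm (f (Suc n)))) {0<..}"
    using has_sum_reindex[OF inj, of "\<lambda>n. norm (f n)"] ran by (simp add: o_def)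
  hence nsumm: "(\<lambda>n. norm (f n)) summable_on {0<..}" by (auto simp: summable_on_def)
  define A where "A = (\<lambda>N. {n::nat. n > 0 \<and> (\<forall>p. prime p \<and> p \<le> N \<longrightarrow> \<not> p dvd n)})"
  have prod: "(\<Prod>p | prime p \<and> p \<le> N. 1 - f p) * zeta s = infsum f (A N)" for N
    using sieved_infsum[of f N] mult summ infsumI[OF hs] by (simp add: A_def)
  have bound: "norm (infsum f (A N) - 1) \<le> (\<Sum>n. norm (f (Suc (n + N))))" for N
  proof -
    have 1: "A N = insert 1 (A N - {1})" by (auto simp: A_def dest: prime_gt_1_nat)
    have sub: "A N - {1} \<subseteq> {N<..}"
    proof
      fix n assume n: "n \<in> A N - {1}"
      then obtain p where p: "prime p" "p dvd n" using prime_factor_nat[of n] by auto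
      have "N < p" using n p unfolding A_def by (metis (no_types, lifting) DiffD1 mem_Collect_eq not_le)
      moreover have "p \<le> n" using p n by (auto simp: A_def intro: dvd_imp_le)
      ultimately show "n \<in> {N<..}" by simp
    qed
    have sA: "f summable_on (A N - {1})"
      by (rule summable_on_subset_banach[OF summ]) (auto simp: A_def)
    have nA: "(\<lambda>n. norm (f n)) summable_on (A N - {1})" "(\<lambda>n. norm (f n)) summable_on {N<..}"
      by (rule summable_on_subset_banach[OF nsumm]; auto simp: A_def)+
    have "infsum f (insert 1 (A N - {1})) = f 1 + infsum f (A N - {1})"
      using infsum_insert[OF sA, of 1] by blast
    hence "infsum f (A N) = f 1 + infsum f (A N - {1})" using 1 by argo
    hence "norm (infsum f (A N) - 1) = norm (infsum f (A N - {1}))" by (simp add: f_def)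
    also have "\<dots> \<le> infsum (\<lambda>n. norm (f n)) (A N - {1})" by (rule norm_infsum_bound[OF nA(1)])
    also have "\<dots> \<le> infsum (\<lambda>n. norm (f n)) {N<..}"
      by (rule infsum_mono_neutral[OF nA]) (use sub in auto)
    also have "\<dots> = (\<Sum>n. norm (f (Suc (n + N))))"
    proof (rule infsumI)
      have "((\<lambda>n. norm (f (Suc (n + N)))) has_sum (\<Sum>n. norm (f (Suc (n + N))))) UNIV"
        using summable_ignore_initial_segment[OF nsum, of N]
        by (intro norm_summable_imp_has_sum) auto
      moreover have "range (\<lambda>n. Suc (n + N)) = {N<..}"
        by (auto simp: image_iff) (metis less_imp_Suc_add add.commute)
      moreover have "inj (\<lambda>n. Suc (n + N))" by (auto simp: inj_on_def)
      ultimately show "((\<lambda>n. norm (f n)) has_sum (\<Sum>n. norm (f (Suc (n + N))))) {N<..}"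
        using has_sum_reindex[of "\<lambda>n. Suc (n + N)" UNIV "\<lambda>n. norm (f n)"] by (simp add: o_def)
    qed
    finally show ?thesis .
  qed
  have "(\<lambda>N. infsum f (A N) - 1) \<longlonglongrightarrow> 0"
  proof (rule Lim_null_comparison)
    show "(\<lambda>N. \<Sum>n. norm (f (Suc (n + N)))) \<longlonglongrightarrow> 0"
      using suminf_exist_split2[OF nsum] by simp
  qed (use bound in auto)
  hence "(\<lambda>N. infsum f (A N)) \<longlonglongrightarrow> 1" by (rule LIM_zero_cancel)
  thus ?thesis unfolding prod[symmetric] by (simp add: f_def)
qed

lemma zeta_nonzero_Re_gt_1: "Re s > 1 \<Longrightarrow> zeta s \<noteq> 0"
  using Euler_product_tendsto[of s] LIMSEQ_unique[OF _ tendsto_const[of 0]] by fastforce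

text \<open>The source is 3 + 4 cos a + cos 2a = 2 (1 + cos a)^2 >= 0: the logarithm of the product
  is the series of -(x^n/n) (3 + 4 w^n + w^(2n)), whose terms have nonpositive real part. In use, x
  = p^(-\<sigma>) and w = p^(-it).\<close>

lemma Mertens_factor_bound:
  fixes x :: real and w :: complex
  assumes x: "0 \<le> x" "x < 1" and w: "norm w = 1"
  shows "norm (1 - of_real x :: complex) ^ 3 * norm (1 - of_real x * w) ^ 4 * norm (1 - of_real x * w\<^sup>2) \<le> 1"
proof -
  define z1 z2 z3 :: complex where "z1 = of_real x" and "z2 = of_real x * w" and "z3 = of_real x * w\<^sup>2"
  have z: "norm z1 < 1" "norm z2 < 1" "norm z3 < 1"
    using x w by (auto simp: z1_def z2_def z3_def norm_mult norm_power)
  have nz: "1 - z1 \<noteq> 0" "1 - z2 \<noteq> 0" "1 - z3 \<noteq> 0" using z by auto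
  \<comment> \<open>The term at n = 0 is a division by 0, hence 0, so the series may be indexed from
    0.\<close>
  have L: "(\<lambda>n. - (z ^ n) / of_nat n) sums Ln (1 - z)" if "norm z < 1" for z :: complex
    using Ln_series'[of "-z"] that by simp
  define S where "S = 3 * Ln (1 - z1) + 4 * Ln (1 - z2) + Ln (1 - z3)"
  have "(\<lambda>n. 3 * (- (z1 ^ n) / of_nat n) + 4 * (- (z2 ^ n) / of_nat n) + (- (z3 ^ n) / of_nat n)) sums S"
    unfolding S_def by (intro sums_add sums_mult L z)
  hence "(\<lambda>n. Re (3 * (- (z1 ^ n) / of_nat n) + 4 * (- (z2 ^ n) / of_nat n) + (- (z3 ^ n) / of_nat n))) sums Re S"
    by (rule sums_Re)
  from _ this sums_zero have "Re S \<le> 0"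
  proof (rule sums_le)
    show "Re (3 * (- (z1 ^ n) / of_nat n) + 4 * (- (z2 ^ n) / of_nat n) + (- (z3 ^ n) / of_nat n)) \<le> 0" for n
    proof -
      define u where "u = w ^ n"
      have u: "(Re u)\<^sup>2 + (Im u)\<^sup>2 = 1"
        using w cmod_power2[of u] by (simp add: u_def norm_power)
      have "3 * (- (z1 ^ n) / of_nat n) + 4 * (- (z2 ^ n) / of_nat n) + (- (z3 ^ n) / of_nat n)
        = of_real (- (x ^ n / real n)) * (3 + 4 * u + u\<^sup>2)"
        by (simp add: z1_def z2_def z3_def u_def power_mult_distrib algebra_simps add_divide_distrib
            flip: power_mult)
      moreover have "Re (of_real r * (3 + 4 * u + u\<^sup>2)) = r * (3 + 4 * Re u + ((Re u)\<^sup>2 - (Im u)\<^sup>2))" for r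
        by (simp add: Re_power2)
      ultimately have "Re (3 * (- (z1 ^ n) / of_nat n) + 4 * (- (z2 ^ n) / of_nat n) + (- (z3 ^ n) / of_nat n))
        = - (x ^ n / real n) * (3 + 4 * Re u + ((Re u)\<^sup>2 - (Im u)\<^sup>2))"
        by presburger
      also have "3 + 4 * Re u + ((Re u)\<^sup>2 - (Im u)\<^sup>2) = 2 * (1 + Re u)\<^sup>2"
        using u by (simp add: power2_eq_square algebra_simps)
      finally show ?thesis using x by simp
    qed
  qed
  moreover have "norm (1 - z1) ^ 3 * norm (1 - z2) ^ 4 * norm (1 - z3) = norm (exp S)"
    using nz exp_of_nat_mult[of 3 "Ln (1 - z1)"] exp_of_nat_mult[of 4 "Ln (1 - z2)"]
    by (simp add: S_def exp_add norm_mult norm_power)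
  ultimately show ?thesis by (simp add: z1_def z2_def z3_def)
qed

text \<open>\<open>Mertens_factor_bound\<close> at each prime bounds the 3-4-1 product of the finite
  Euler products by 1, while each of these times its value of \<zeta> tends to 1 in modulus.\<close>

lemma zeta_3_4_1:
  assumes "\<sigma> > 1"
  shows "1 \<le> norm (zeta (of_real \<sigma>)) ^ 3 * norm (zeta (Complex \<sigma> t)) ^ 4 * norm (zeta (Complex \<sigma> (2 * t)))"
proof -
  define P where "P = (\<lambda>N s. \<Prod>p | prime p \<and> p \<le> (N::nat). 1 - of_nat p powr - s :: complex)"
  define X where "X = norm (zeta (of_real \<sigma>)) ^ 3 * norm (zeta (Complex \<sigma> t)) ^ 4 * norm (zeta (Complex \<sigma> (2 * t)))"
  have lim: "(\<lambda>N. norm (P N s * zeta s)) \<longlonglongrightarrow> 1" if "Re s > 1" for s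
    using tendsto_norm[OF Euler_product_tendsto[OF that]] by (simp add: P_def)
  have "(\<lambda>N. norm (P N (of_real \<sigma>) * zeta (of_real \<sigma>)) ^ 3 * norm (P N (Complex \<sigma> t) * zeta (Complex \<sigma> t)) ^ 4
      * norm (P N (Complex \<sigma> (2 * t)) * zeta (Complex \<sigma> (2 * t)))) \<longlonglongrightarrow> 1 ^ 3 * 1 ^ 4 * 1"
    by (intro tendsto_mult tendsto_power lim) (use assms in auto)
  moreover have "norm (P N (of_real \<sigma>) * zeta (of_real \<sigma>)) ^ 3 * norm (P N (Complex \<sigma> t) * zeta (Complex \<sigma> t)) ^ 4
      * norm (P N (Complex \<sigma> (2 * t)) * zeta (Complex \<sigma> (2 * t))) \<le> X" for N
  proof -
    have "norm (P N (of_real \<sigma>)) ^ 3 * norm (P N (Complex \<sigma> t)) ^ 4 * norm (P N (Complex \<sigma> (2 * t)))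
      = (\<Prod>p | prime p \<and> p \<le> N. norm (1 - of_nat p powr - of_real \<sigma> :: complex) ^ 3 *
           norm (1 - of_nat p powr - Complex \<sigma> t) ^ 4 * norm (1 - of_nat p powr - Complex \<sigma> (2 * t)))"
      by (simp add: P_def prod_norm[symmetric] prod_power_distrib prod.distrib)
    also have "\<dots> \<le> 1"
    proof (intro prod_le_1 conjI)
      fix p :: nat assume "p \<in> {p. prime p \<and> p \<le> N}"
      hence p: "p > 1" using prime_gt_1_nat by auto
      define x where "x = real p powr - \<sigma>"
      define w where "w = of_nat p powr Complex 0 (- t)"
      have "x < 1" using p assms by (simp add: x_def powr_less_one)
      have "norm w = 1" using p by (simp add: w_def norm_powr_real_powr)
      have "Complex 0 (- t) + Complex 0 (- t) = Complex 0 (- 2 * t)" by (simp add: complex_eq_iff)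
      hence w2: "w\<^sup>2 = of_nat p powr Complex 0 (- 2 * t)"
        unfolding w_def power2_eq_square powr_add[symmetric] by (rule arg_cong)
      have x': "complex_of_real x = of_nat p powr of_real (- \<sigma>)"
        using powr_of_real[of "real p" "- \<sigma>"] by (simp add: x_def)
      have "of_nat p powr - of_real \<sigma> = complex_of_real x" by (simp add: x')
      moreover have "of_nat p powr - Complex \<sigma> t = of_real x * w"
        unfolding x' w_def powr_add[symmetric] by (simp add: complex_eq_iff[of "- Complex \<sigma> t"] Complex_eq)
      moreover have "of_nat p powr - Complex \<sigma> (2 * t) = of_real x * w\<^sup>2"
        unfolding x' w2 powr_add[symmetric] by (simp add: Complex_eq)
      ultimately show "norm (1 - of_nat p powr - of_real \<sigma> :: complex) ^ 3 *
           norm (1 - of_nat p powr - Complex \<sigma> t) ^ 4 * norm (1 - of_nat p powr - Complex \<sigma> (2 * t)) \<le> 1"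
        using Mertens_factor_bound[of x w] \<open>x < 1\<close> \<open>norm w = 1\<close> by (simp add: x_def)
    qed auto
    finally have "norm (P N (of_real \<sigma>)) ^ 3 * norm (P N (Complex \<sigma> t)) ^ 4 * norm (P N (Complex \<sigma> (2 * t))) * X \<le> 1 * X"
      by (intro mult_right_mono) (auto simp: X_def)
    thus ?thesis by (simp add: X_def norm_mult power_mult_distrib mult_ac)
  qed
  ultimately show ?thesis unfolding X_def[symmetric] by (intro LIMSEQ_le_const2) auto
qed

text \<open>A zero at 1 + it would make the fourth power at 1 + h + it of order O(h^4), against
  O(h^(-3)) from the pole at 1. The surplus factor h sends the product in \<open>zeta_3_4_1\<close>
  to 0, below its lower bound 1.\<close>

lemma zeta_nonzero_Re_eq_1:
  assumes "t \<noteq> 0"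
  shows "zeta (Complex 1 t) \<noteq> 0"
proof
  assume z: "zeta (Complex 1 t) = 0"
  obtain C where C: "C > 0" "\<And>s. Re s \<ge> 1/8 \<Longrightarrow> s \<noteq> 1 \<Longrightarrow> norm ((s - 1) * zeta s) \<le> 1 + C * norm s * norm (s - 1)"
    using zeta_pole_bound by blast
  have ne: "Complex 1 t \<noteq> 1" "Complex 1 (2 * t) \<noteq> 1" using assms by (auto simp: complex_eq_iff)
  have der: "(zeta has_field_derivative deriv zeta s) (at s)" if "s \<noteq> 1" for s
    by (rule holomorphic_derivI[OF holomorphic_zeta]) (use that in auto)
  have path: "((\<lambda>h. Complex (1 + h) u) \<longlongrightarrow> Complex 1 u) (at_right 0)" for u
    unfolding Complex_eq by (auto intro!: tendsto_eq_intros)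
  have "((\<lambda>s. (zeta s - zeta (Complex 1 t)) / (s - Complex 1 t)) \<longlongrightarrow> deriv zeta (Complex 1 t)) (at (Complex 1 t))"
    using der[OF ne(1)] by (simp add: has_field_derivative_iff)
  hence "((\<lambda>h. (zeta (Complex (1 + h) t) - zeta (Complex 1 t)) / (Complex (1 + h) t - Complex 1 t)) \<longlongrightarrow> deriv zeta (Complex 1 t)) (at_right 0)"
    by (rule filterlim_compose)
       (auto simp: filterlim_at path complex_eq_iff eventually_at_filter)
  hence "((\<lambda>h. zeta (Complex (1 + h) t) / of_real h) \<longlongrightarrow> deriv zeta (Complex 1 t)) (at_right 0)"
    using z by (simp add: Complex_eq)
  hence l1: "((\<lambda>h. norm (zeta (Complex (1 + h) t) / of_real h)) \<longlongrightarrow> norm (deriv zeta (Complex 1 t))) (at_right 0)"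
    by (rule tendsto_norm)
  have "isCont zeta (Complex 1 (2 * t))" using der[OF ne(2)] by (rule DERIV_isCont)
  hence l2: "((\<lambda>h. norm (zeta (Complex (1 + h) (2 * t)))) \<longlongrightarrow> norm (zeta (Complex 1 (2 * t)))) (at_right 0)"
    by (intro tendsto_norm isCont_tendsto_compose[OF _ path])
  \<comment> \<open>The constant 1 + C * 2 bounds h |\<zeta>(1 + h)| for 0 < h < 1, because (1 + h)
    h <= 2.\<close>
  have "((\<lambda>h. (1 + C * 2) ^ 3 * norm (zeta (Complex (1 + h) t) / of_real h) ^ 4 * h * norm (zeta (Complex (1 + h) (2 * t))))
     \<longlongrightarrow> (1 + C * 2) ^ 3 * norm (deriv zeta (Complex 1 t)) ^ 4 * 0 * norm (zeta (Complex 1 (2 * t)))) (at_right 0)"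
    by (intro tendsto_intros l1 l2) 
  moreover have "eventually (\<lambda>h. 1 \<le> (1 + C * 2) ^ 3 * norm (zeta (Complex (1 + h) t) / of_real h) ^ 4 * h *
      norm (zeta (Complex (1 + h) (2 * t)))) (at_right (0::real))"
  proof -
    have "eventually (\<lambda>h::real. h \<in> {0<..<1}) (at_right 0)" by (rule eventually_at_right_real) simp
    thus ?thesis
    proof eventually_elim
      case (elim h)
      have scale: "(h * a) ^ 3 * ((b / h) ^ 4 * h * c) = a ^ 3 * b ^ 4 * c" for a b c :: real
        using elim by (simp add: power_mult_distrib power_divide eval_nat_numeral)
      have nd: "norm (z / of_real h) = norm z / h" for z :: complex
        using elim by (simp add: norm_divide)
      have "norm ((of_real (1 + h) - 1) * zeta (of_real (1 + h))) \<le> 1 + C * norm (of_real (1 + h) :: complex) * norm (of_real (1 + h) - 1 :: complex)"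
        by (rule C(2)) (use elim in auto)
      also have "norm (of_real (1 + h) :: complex) = 1 + h" using elim by (subst norm_of_real) simp
      also have "norm (of_real (1 + h) - 1 :: complex) = h" using elim by simp
      also have "1 + C * (1 + h) * h = 1 + C * ((1 + h) * h)" by simp
      also have "\<dots> \<le> 1 + C * (2 * 1)" using elim C(1) by (intro add_mono mult_left_mono mult_mono) auto
      finally have b: "h * norm (zeta (of_real (1 + h))) \<le> 1 + C * 2" using elim by (simp add: norm_mult)
      have "1 \<le> norm (zeta (of_real (1 + h))) ^ 3 * norm (zeta (Complex (1 + h) t)) ^ 4 * norm (zeta (Complex (1 + h) (2 * t)))"
        by (rule zeta_3_4_1) (use elim in auto)
      also have "\<dots> = (h * norm (zeta (of_real (1 + h)))) ^ 3 * (norm (zeta (Complex (1 + h) t) / of_real h) ^ 4 * h * norm (zeta (Complex (1 + h) (2 * t))))"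
        by (simp only: scale nd)
      also have "\<dots> \<le> (1 + C * 2) ^ 3 * (norm (zeta (Complex (1 + h) t) / of_real h) ^ 4 * h * norm (zeta (Complex (1 + h) (2 * t))))"
        using elim b by (intro mult_right_mono power_mono) auto
      finally show ?case by (simp add: mult.assoc)
    qed
  qed
  ultimately have "1 \<le> (1 + C * 2) ^ 3 * norm (deriv zeta (Complex 1 t)) ^ 4 * 0 * norm (zeta (Complex 1 (2 * t)))"
    by (rule tendsto_lowerbound) simp
  thus False by simp
qed

text \<open>\<open>Riemann_hypothesis\<close> speaks only of the open strip 0 < Re s < 1, whereas
  the discs used below reach past it.\<close>

lemma zeta_nonzero_Re_ge_1: "Re s \<ge> 1 \<Longrightarrow> Im s \<noteq> 0 \<Longrightarrow> zeta s \<noteq> 0"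
  using zeta_nonzero_Re_gt_1[of s] zeta_nonzero_Re_eq_1[of "Im s"] complex_surj[of s]
  by (cases "Re s = 1") auto

subsection \<open>From zero-free regions to subpolynomial bounds\<close>

text \<open>Replaces the linear growth bound by t * t, free of C, so that its logarithm is 2 ln t.
  The 9 is 6 + 3, the bounds for Re z and |Im z - t| on the disc around 3 + it.\<close>

lemma linear_le_square:
  fixes C t :: real
  assumes "1 \<le> C" "9 \<le> t" "2 * C \<le> t"
  shows "C * (t + 9) \<le> t * t"
proof -
  have "C * 9 \<le> C * t" using assms by (intro mult_left_mono) auto
  moreover have "2 * C * t \<le> t * t" using assms by (intro mult_right_mono) auto
  ultimately show ?thesis unfolding distrib_left by linarith
qed

text \<open>Here ln |w| lies between -7/3 and 7/10 and |Im (Ln w)| < pi/2. This controls the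
  logarithm of \<zeta> at the centre 3 + it.\<close>

lemma norm_Ln_less_5:
  assumes "norm (w - 1) \<le> 7 / 10"
  shows "norm (Ln w) < 5"
proof -
  have w: "3 / 10 \<le> norm w" "norm w \<le> 17 / 10"
    using assms norm_triangle_ineq2[of 1 "1 - w"] norm_triangle_ineq2[of w 1]
    by (auto simp: norm_minus_commute)
  have "\<bar>Re (w - 1)\<bar> \<le> 7 / 10" using abs_Re_le_cmod[of "w - 1"] assms by linarith
  hence "0 < Re w" unfolding abs_le_iff by simp
  hence "w \<noteq> 0" by auto
  hence "\<bar>Im (Ln w)\<bar> < pi / 2" using \<open>0 < Re w\<close> Re_Ln_pos_lt by blast
  moreover have "ln (norm w) \<le> 7 / 10" using ln_le_minus_one[of "norm w"] w \<open>w \<noteq> 0\<close> by simp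
  moreover have "- ln (norm w) \<le> 7 / 3"
  proof -
    have "- ln (norm w) = ln (inverse (norm w))" using w by (simp add: ln_inverse)
    also have "\<dots> \<le> inverse (norm w) - 1" using w by (intro ln_le_minus_one) auto
    also have "inverse (norm w) \<le> inverse (3 / 10)" using w by (intro le_imp_inverse_le) auto
    finally show ?thesis by simp
  qed
  ultimately show ?thesis
    using cmod_le[of "Ln w"] \<open>w \<noteq> 0\<close> pi_less_4 by simp
qed

text \<open>
  On a disc around $3 + it$ the function $\log\zeta$ is $O(\log t)$ by Borel--Caratheodory, but it is $O(1)$ on
  the part where the Dirichlet series dominates; interpolating between the two gives $o(\log t)$.
\<close>

lemma zeta_subpolynomial_zero_free:
  assumes \<sigma>: "1 / 8 \<le> \<sigma>\<^sub>0" "\<sigma>\<^sub>0 \<le> 1 / 2" and \<delta>: "0 < \<delta>" "\<delta> \<le> 1" and \<epsilon>: "0 < \<epsilon>"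
  obtains T where "T \<ge> 9"
    "\<And>s. Im s \<ge> T \<Longrightarrow> \<sigma>\<^sub>0 + \<delta> \<le> Re s \<Longrightarrow> Re s \<le> 3 \<Longrightarrow>
       (\<And>z. \<sigma>\<^sub>0 < Re z \<Longrightarrow> \<bar>Im z - Im s\<bar> < 3 \<Longrightarrow> zeta z \<noteq> 0) \<Longrightarrow> norm (zeta s) \<le> Im s powr \<epsilon>"
proof -
  obtain C where C: "C \<ge> 1" "\<And>s. Re s \<ge> 1/8 \<Longrightarrow> \<bar>Im s\<bar> \<ge> 1 \<Longrightarrow> norm (zeta s) \<le> C * norm s"
    using zeta_linear_bound by blast
  \<comment> \<open>The disc of radius R around 3 + it touches the line with abscissa
    \<open>\<sigma>\<^sub>0\<close> and, since R < 3, stays in the zero-free window of height 3.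
    Radius r2 reaches the points to be estimated; r3 lies halfway between r2 and R.\<close>
  define R where "R = 3 - \<sigma>\<^sub>0"
  define r3 where "r3 = R - \<delta> / 2"
  define r2 where "r2 = R - \<delta>"
  \<comment> \<open>84 / \<delta> is 2 * 7 * 3 divided by R - r3 = \<delta>/2, using 2 ln t + 5 <= 7
    ln t and r3 <= 3; the added 5 pays for g c.\<close>
  define D where "D = 84 / \<delta> + 5"
  have r: "R < 3" "1 \<le> R" "1 / 2 \<le> r2" "r2 < r3" "r3 < R" "0 < r3"
    using \<sigma> \<delta> by (auto simp: R_def r3_def r2_def)
  have D: "D > 0" using \<delta> by (simp add: D_def add_pos_pos)
  obtain N where N: "(r2 / r3) ^ N < \<epsilon> / (2 * D)"
    using real_arch_pow_inv[of "\<epsilon> / (2 * D)" "r2 / r3"] \<epsilon> D r by auto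
  \<comment> \<open>N is fixed before t, so the inner contribution 17 (2 r2)^N is a constant, and
    the exponential makes it at most (\<epsilon>/2) ln t. The 17 is 12 from Borel--Caratheodory on
    the disc where the Dirichlet series dominates, plus 5 for g c.\<close>
  define T where "T = max (max 9 (2 * C)) (exp (34 * (r2 / (1 / 2)) ^ N / \<epsilon>))"
  show ?thesis
  proof (rule that[of T])
    fix s
    assume T: "Im s \<ge> T" and s: "\<sigma>\<^sub>0 + \<delta> \<le> Re s" "Re s \<le> 3"
      and nz: "\<And>z. \<sigma>\<^sub>0 < Re z \<Longrightarrow> \<bar>Im z - Im s\<bar> < 3 \<Longrightarrow> zeta z \<noteq> 0"
    define t where "t = Im s"
    have t: "9 \<le> t" "2 * C \<le> t" "exp (34 * (r2 / (1 / 2)) ^ N / \<epsilon>) \<le> t"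
      using T by (auto simp: T_def t_def)
    have ln_t: "1 \<le> ln t" using t(1) exp_le by (subst ln_ge_iff) auto
    have ln_t2: "34 * (r2 / (1 / 2)) ^ N / \<epsilon> \<le> ln t" using t by (subst ln_ge_iff) auto
    define c where "c = Complex 3 t"
    have in_ball: "\<sigma>\<^sub>0 < Re z" "Re z < 6" "\<bar>Im z - t\<bar> < 3" if "z \<in> ball c R" for z
    proof -
      have "\<bar>Re (z - c)\<bar> < R" "\<bar>Im (z - c)\<bar> < R"
        using that abs_Re_le_cmod[of "z - c"] abs_Im_le_cmod[of "z - c"]
        by (auto simp: dist_norm norm_minus_commute)
      thus "\<sigma>\<^sub>0 < Re z" "Re z < 6" "\<bar>Im z - t\<bar> < 3" using r unfolding abs_less_iff by (auto simp: c_def R_def)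
    qed
    have hol: "zeta holomorphic_on ball c R"
      by (rule holomorphic_on_subset[OF holomorphic_zeta]) (use in_ball t in force)
    have nz_ball: "zeta z \<noteq> 0" if "z \<in> ball c R" for z
      using in_ball[OF that] by (intro nz) (auto simp: t_def)
    have "R > 0" using r by simp
    obtain g where g: "g holomorphic_on ball c R" "\<And>z. z \<in> ball c R \<Longrightarrow> zeta z = exp (g z)"
        "g c = Ln (zeta c)"
      using holomorphic_log_ball[OF hol \<open>R > 0\<close> nz_ball] by blast
    have gc: "norm (g c) < 5"
      unfolding g(3) using norm_zeta_minus_1_le[of c] pi_squared_bound
      by (intro norm_Ln_less_5) (auto simp: c_def)
    have Re_g: "Re (g z) = ln (norm (zeta z))" if "z \<in> ball c R" for z
      using g(2)[OF that] by simp
    have BC1: "norm (g z - g c) \<le> 2 * 6 * (1 / 2) / (1 - 1 / 2)" if "dist c z \<le> 1 / 2" for z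
    proof (rule Borel_Caratheodory[OF _ _ _ that])
      have sub: "ball c 1 \<subseteq> ball c R" using r by auto
      show "g holomorphic_on ball c 1" using g(1) sub by (rule holomorphic_on_subset)
      fix w assume w: "w \<in> ball c 1"
      have "\<bar>Re (w - c)\<bar> < 1"
        using w abs_Re_le_cmod[of "w - c"] by (auto simp: dist_norm norm_minus_commute)
      hence "Re w \<ge> 2" unfolding abs_less_iff by (simp add: c_def)
      hence "norm (zeta w - 1) \<le> 7 / 10" using norm_zeta_minus_1_le[of w] pi_squared_bound by linarith
      hence "norm (zeta w) \<le> 17 / 10" using norm_triangle_ineq2[of "zeta w" 1] by simp
      moreover have "0 < norm (zeta w)" using g(2)[of w] w sub by auto
      ultimately have "ln (norm (zeta w)) \<le> 7 / 10" using ln_le_minus_one[of "norm (zeta w)"] by linarith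
      moreover have "\<bar>Re (g c)\<bar> < 5" using abs_Re_le_cmod[of "g c"] gc by linarith
      ultimately show "Re (g w - g c) < 6" using Re_g[of w] w sub by auto
    qed auto
    have M1: "norm (g z) \<le> 17" if "dist c z \<le> 1 / 2" for z
      using BC1[OF that] norm_triangle_ineq2[of "g z" "g c"] gc by simp
    have BC2: "norm (g z - g c) \<le> 2 * (2 * ln t + 5) * r3 / (R - r3)" if "dist c z \<le> r3" for z
    proof (rule Borel_Caratheodory[OF g(1) _ _ that])
      fix w assume w: "w \<in> ball c R"
      note w' = in_ball[OF w]
      have "norm (zeta w) \<le> C * norm w" by (rule C(2)) (use w' \<sigma> t in auto)
      also have "norm w \<le> t + 9" using cmod_le[of w] w' \<sigma> t by linarith
      also have "C * (t + 9) \<le> t * t" by (rule linear_le_square) (use C(1) t in auto)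
      finally have "norm (zeta w) \<le> t * t" using C(1) by simp
      moreover have "0 < norm (zeta w)" using g(2)[OF w] by simp
      ultimately have "ln (norm (zeta w)) \<le> ln (t * t)" using t by (subst ln_le_cancel_iff) auto
      also have "\<dots> = 2 * ln t" using t by (simp add: ln_mult)
      finally have "Re (g w) \<le> 2 * ln t" using Re_g[OF w] by simp
      moreover have "\<bar>Re (g c)\<bar> < 5" using abs_Re_le_cmod[of "g c"] gc by linarith
      ultimately show "Re (g w - g c) < 2 * ln t + 5" by simp
    qed (use r in auto)
    have D_ln: "2 * (2 * ln t + 5) * r3 / (R - r3) + 5 \<le> D * ln t"
    proof -
      have "2 * (2 * ln t + 5) * r3 \<le> 2 * (7 * ln t) * 3"
        using ln_t r by (intro mult_mono) auto
      hence "2 * (2 * ln t + 5) * r3 / (R - r3) \<le> 2 * (7 * ln t) * 3 / (R - r3)"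
        using r by (intro divide_right_mono) auto
      also have "\<dots> = 84 / \<delta> * ln t" using \<delta> by (simp add: r3_def field_simps)
      finally show ?thesis using ln_t by (simp add: D_def algebra_simps)
    qed
    have M3: "norm (g z) \<le> D * ln t" if "dist c z \<le> r3" for z
      using BC2[OF that] D_ln norm_triangle_ineq2[of "g z" "g c"] gc by linarith
    have sdist: "dist c s \<le> r2"
    proof -
      have "c - s = of_real (3 - Re s)" by (simp add: c_def t_def complex_eq_iff)
      hence "dist c s = \<bar>3 - Re s\<bar>" unfolding dist_norm by (metis norm_of_real)
      thus ?thesis using s by (simp add: r2_def R_def)
    qed
    have "norm (g s) \<le> 17 * (r2 / (1 / 2)) ^ N + (D * ln t) * (r2 / r3) ^ N"
      by (rule maximum_modulus_annulus[OF g(1) _ _ _ _ M1 M3 sdist]) (use r in auto)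
    also have "17 * (r2 / (1 / 2)) ^ N \<le> \<epsilon> / 2 * ln t" using ln_t2 \<epsilon> by (simp add: field_simps)
    also have "(D * ln t) * (r2 / r3) ^ N \<le> (D * ln t) * (\<epsilon> / (2 * D))"
      using N D ln_t by (intro mult_left_mono) auto
    also have "\<dots> = \<epsilon> / 2 * ln t" using D by simp
    finally have gs: "norm (g s) \<le> \<epsilon> * ln t" by simp
    have "norm (zeta s) = exp (Re (g s))" using g(2)[of s] sdist r by simp
    also have "\<dots> \<le> exp (\<epsilon> * ln t)" using gs abs_Re_le_cmod[of "g s"] by simp
    also have "\<dots> = t powr \<epsilon>" using t by (simp add: powr_def)
    finally show "norm (zeta s) \<le> Im s powr \<epsilon>" by (simp add: t_def)
  qed (simp add: T_def)
qed

lemma RH_zeta_nonzero: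
  assumes "Riemann_hypothesis" "Re s > 1 / 2" "Im s \<noteq> 0"
  shows "zeta s \<noteq> 0"
  using assms zeta_nonzero_Re_ge_1[of s] unfolding Riemann_hypothesis_def by fastforce

text \<open>
  The line itself may contain zeros, so here $\zeta$ instead of $\log\zeta$ is interpolated, with an
  exponent $N$ proportional to $\log t$ that absorbs the trivial bound on the outer circle.
\<close>

lemma zeta_subpolynomial_critical_line:
  assumes RH: "Riemann_hypothesis" and \<epsilon>: "0 < \<epsilon>"
  obtains \<eta> T where "0 < \<eta>" "\<eta> \<le> 1 / 8" "T \<ge> 9"
    "\<And>t s. t \<ge> T \<Longrightarrow> dist (1 / 2 + \<i> * of_real t) s \<le> \<eta> \<Longrightarrow> norm (zeta s) \<le> t powr \<epsilon>"
proof -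
  obtain C where C: "C \<ge> 1" "\<And>s. Re s \<ge> 1/8 \<Longrightarrow> \<bar>Im s\<bar> \<ge> 1 \<Longrightarrow> norm (zeta s) \<le> C * norm s"
    using zeta_linear_bound by blast
  \<comment> \<open>336 = 4 * 84 and 84 = 4 * 21: the ratio of the middle to the inner radius will
    be at most exp (4\<eta>), and N at most 21 ln t, so the N-th power of the ratio is at most t
    powr (\<epsilon> / 4).\<close>
  define \<eta> where "\<eta> = min (1 / 8) (\<epsilon> / 336)"
  have \<eta>: "0 < \<eta>" "\<eta> \<le> 1 / 8" "84 * \<eta> \<le> \<epsilon> / 4" using \<epsilon> by (auto simp: \<eta>_def)
  obtain T1 where T1: "T1 \<ge> 9"
    "\<And>s. Im s \<ge> T1 \<Longrightarrow> 1 / 2 + \<eta> \<le> Re s \<Longrightarrow> Re s \<le> 3 \<Longrightarrow>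
       (\<And>z. 1 / 2 < Re z \<Longrightarrow> \<bar>Im z - Im s\<bar> < 3 \<Longrightarrow> zeta z \<noteq> 0) \<Longrightarrow> norm (zeta s) \<le> Im s powr (\<epsilon> / 8)"
    by (rule zeta_subpolynomial_zero_free[of "1 / 2" \<eta> "\<epsilon> / 8"]) (use \<eta> \<epsilon> in auto)
  define T where "T = max (T1 + 1) (max (2 * C) (2 powr (2 / \<epsilon>)))"
  show ?thesis
  proof (rule that[OF \<eta>(1,2), of T])
    show "T \<ge> 9" using T1 by (simp add: T_def)
    fix t s assume T: "t \<ge> T" and s: "dist (1 / 2 + \<i> * of_real t) s \<le> \<eta>"
    have t: "t \<ge> T1 + 1" "t \<ge> 10" "2 * C \<le> t" "2 powr (2 / \<epsilon>) \<le> t" using T T1(1) by (auto simp: T_def)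
    have ln_t: "1 \<le> ln t" using t exp_le by (subst ln_ge_iff) auto
    \<comment> \<open>Around 3/2 + it, radius 1 - \<eta> stays in Re z >= 1/2 + \<eta>, where the
      zero-free estimate applies; radius 1 + \<eta> covers the small disc about 1/2 + it; radius 5/4
      stays in Re z >= 1/4, where growth is linear.\<close>
    define c where "c = 3 / 2 + \<i> * of_real t"
    \<comment> \<open>The 20 cancels the trivial bound t * t: (1 + \<eta>) / (5/4) <= 9/10 <= exp
      (-1/10), and exp (-N/10) <= t^(-2).\<close>
    define N where "N = nat \<lceil>20 * ln t\<rceil>"
    have N: "20 * ln t \<le> real N" "real N \<le> 21 * ln t" using ln_t unfolding N_def by linarith+
    have coords: "\<bar>Re z - 3 / 2\<bar> \<le> dist c z" "\<bar>Im z - t\<bar> \<le> dist c z" for z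
      using abs_Re_le_cmod[of "z - c"] abs_Im_le_cmod[of "z - c"]
      by (auto simp: dist_norm norm_minus_commute c_def)
    have "norm (zeta s) \<le> t powr (\<epsilon> / 4) * ((1 + \<eta>) / (1 - \<eta>)) ^ N + (t * t) * ((1 + \<eta>) / (5 / 4)) ^ N"
    proof (rule maximum_modulus_annulus[where f = zeta and z = s and c = c and R = "11 / 8"])
      show "zeta holomorphic_on ball c (11 / 8)"
      proof (rule holomorphic_on_subset[OF holomorphic_zeta])
        show "ball c (11 / 8) \<subseteq> - {1}" using coords(2)[of 1] t by (auto simp: not_less)
      qed
      have "dist c s \<le> dist c (1 / 2 + \<i> * of_real t) + dist (1 / 2 + \<i> * of_real t) s"
        by (rule dist_triangle)
      thus "dist c s \<le> 1 + \<eta>" using s by (simp add: c_def dist_norm)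
    next
      fix z assume z: "dist c z \<le> 1 - \<eta>"
      note z' = order_trans[OF coords(1)[of z] z] order_trans[OF coords(2)[of z] z]
      have "norm (zeta z) \<le> Im z powr (\<epsilon> / 8)"
      proof (rule T1(2))
        fix u assume u: "1 / 2 < Re u" "\<bar>Im u - Im z\<bar> < 3"
        show "zeta u \<noteq> 0" by (rule RH_zeta_nonzero[OF RH]) (use u z' \<eta> t in auto)
      qed (use z' \<eta> t in \<open>auto simp: abs_if split: if_splits\<close>)
      also have "\<dots> \<le> (t * t) powr (\<epsilon> / 8)"
      proof (rule powr_mono2)
        have "Im z \<le> 10 * t" "0 \<le> Im z" using z' t \<eta> by (auto simp: abs_if split: if_splits)
        moreover have "10 * t \<le> t * t" using t by simp
        ultimately show "Im z \<le> t * t" "0 \<le> Im z" by linarith+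
      qed (use \<epsilon> in auto)
      also have "\<dots> = t powr (\<epsilon> / 4)" using t by (simp add: powr_mult flip: powr_add)
      finally show "norm (zeta z) \<le> t powr (\<epsilon> / 4)" .
    next
      fix z assume z: "dist c z \<le> 5 / 4"
      note z' = order_trans[OF coords(1)[of z] z] order_trans[OF coords(2)[of z] z]
      have "norm (zeta z) \<le> C * norm z" by (rule C(2)) (use z' t in \<open>auto simp: abs_if split: if_splits\<close>)
      also have "norm z \<le> t + 9" using cmod_le[of z] z' t by (auto simp: abs_if split: if_splits)
      also have "C * (t + 9) \<le> t * t" by (rule linear_le_square) (use C(1) t in auto)
      finally show "norm (zeta z) \<le> t * t" using C(1) by simp
    qed (use \<eta> in auto)
    also have "((1 + \<eta>) / (1 - \<eta>)) ^ N \<le> t powr (\<epsilon> / 4)"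
    proof -
      have "(1 + \<eta>) / (1 - \<eta>) \<le> 1 + 4 * \<eta>" using \<eta> mult_left_mono[of \<eta> "1 / 8" \<eta>]
        by (simp add: field_simps)
      also have "\<dots> \<le> exp (4 * \<eta>)" by (rule exp_ge_add_one_self)
      finally have "((1 + \<eta>) / (1 - \<eta>)) ^ N \<le> exp (4 * \<eta>) ^ N" using \<eta> by (intro power_mono) auto
      also have "\<dots> = exp (4 * \<eta> * real N)" by (simp add: mult.commute flip: exp_of_nat_mult)
      also have "4 * \<eta> * real N \<le> 4 * \<eta> * (21 * ln t)" using N \<eta> by (intro mult_left_mono) auto
      also have "\<dots> \<le> \<epsilon> / 4 * ln t" using mult_right_mono[OF \<eta>(3), of "ln t"] ln_t by simp
      finally show ?thesis using t by (simp add: powr_def)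
    qed
    also have "((1 + \<eta>) / (5 / 4)) ^ N \<le> 1 / (t * t)"
    proof -
      have "(1 + \<eta>) / (5 / 4) \<le> 1 + - (1 / 10)" using \<eta> by simp
      also have "\<dots> \<le> exp (- (1 / 10))" by (rule exp_ge_add_one_self)
      finally have "((1 + \<eta>) / (5 / 4)) ^ N \<le> exp (- (1 / 10)) ^ N" using \<eta> by (intro power_mono) auto
      also have "\<dots> = exp (- (1 / 10) * real N)" by (simp add: mult.commute flip: exp_of_nat_mult)
      also have "\<dots> \<le> exp (- (ln t + ln t))" using N by simp
      also have "\<dots> = 1 / (t * t)" unfolding exp_minus exp_add using t by (simp add: field_simps)
      finally show ?thesis .
    qed
    finally have "norm (zeta s) \<le> t powr (\<epsilon> / 4) * t powr (\<epsilon> / 4) + t * t * (1 / (t * t))"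
      using t by (simp add: mult_left_mono)
    also have "\<dots> = t powr (\<epsilon> / 2) + 1" using t by (simp flip: powr_add)
    \<comment> \<open>This is x + 1 <= x * x for x >= 2; the term 2 powr (2 / \<epsilon>) in T
      provides x >= 2.\<close>
    also have "\<dots> \<le> t powr (\<epsilon> / 2) * t powr (\<epsilon> / 2)"
    proof -
      have "(2 powr (2 / \<epsilon>)) powr (\<epsilon> / 2) \<le> t powr (\<epsilon> / 2)" using t \<epsilon> by (intro powr_mono2) auto
      hence "2 \<le> t powr (\<epsilon> / 2)" using \<epsilon> by (simp add: powr_powr)
      thus ?thesis using mult_right_mono[of 2 "t powr (\<epsilon> / 2)" "t powr (\<epsilon> / 2)"] by linarith
    qed
    also have "\<dots> = t powr \<epsilon>" by (simp flip: powr_add)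
    finally show "norm (zeta s) \<le> t powr \<epsilon>" .
  qed
qed

subsection \<open>Gaps between ordinates of zeros\<close>

text \<open>Both cases apply ln x <= x - 1 to a ratio; the factor 2 is n + 1 <= 2n, from the upper
  neighbour m = n + 1. The bound depends on n alone, so it can be taken out of sums over arbitrarily
  many m.\<close>

lemma ln_diff_lower_bound:
  assumes "n \<ge> 1" "m \<ge> 1" "n \<noteq> m"
  shows "1 / (2 * real n) \<le> \<bar>ln (real n) - ln (real m)\<bar>"
proof -
  have *: "1 - x / y \<le> ln y - ln x" if "x > 0" "y > 0" for x y :: real
    using ln_le_minus_one[of "x / y"] that by (simp add: ln_div)
  show ?thesis
  proof (cases "m < n")
    case True
    have "1 / (2 * real n) \<le> 1 - real m / real n" using True by (simp add: field_simps)
    also have "\<dots> \<le> ln (real n) - ln (real m)" by (rule *) (use assms in auto)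
    finally show ?thesis by linarith
  next
    case False
    hence "real n / real m \<le> real n / (real n + 1)" using assms by (intro divide_left_mono) auto
    moreover have "1 / (2 * real n) \<le> 1 - real n / (real n + 1)" using assms by (simp add: field_simps)
    moreover have "1 - real n / real m \<le> ln (real m) - ln (real n)" by (rule *) (use assms in auto)
    ultimately show ?thesis by linarith
  qed
qed

lemma zeta_term_eq_exp: "1 / of_nat (Suc m) powr s = exp (- s * complex_of_real (ln (real (Suc m))))"
proof -
  have "Ln (of_nat (Suc m)) = of_real (ln (real (Suc m)))"
    using Ln_of_real[of "real (Suc m)"] by simp
  moreover have "of_nat (Suc m) \<noteq> (0 :: complex)" by (simp del: of_nat_Suc)
  ultimately have "of_nat (Suc m) powr s = exp (s * of_real (ln (real (Suc m))))"
    unfolding powr_def by (simp only: if_False)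
  thus ?thesis by (simp add: exp_minus inverse_eq_divide del: of_nat_Suc)
qed

text \<open>
  On the line of real part $1/4$ this is the complex conjugate of $\sum_{n \le N} n^{-s}$; written
  this way it is entire in $s$, so that its product with $\zeta$ has a primitive.
\<close>

definition zeta_resonator :: "nat \<Rightarrow> complex \<Rightarrow> complex" where
  "zeta_resonator N s = (\<Sum>n\<in>{1..N}. exp ((s - 1 / 2) * of_real (ln (real n))))"

lemma norm_zeta_resonator_le:
  assumes "Re s \<le> 2"
  shows "norm (zeta_resonator N s) \<le> real N ^ 3"
proof -
  have "norm (exp ((s - 1 / 2) * of_real (ln (real n)))) \<le> real N ^ 2" if "n \<in> {1..N}" for n
  proof -
    have "norm (exp ((s - 1 / 2) * of_real (ln (real n)))) = exp ((Re s - 1 / 2) * ln (real n))"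
      by simp
    also have "\<dots> \<le> exp (2 * ln (real n))"
      using assms that by (intro exp_mono mult_right_mono) auto
    also have "\<dots> = real n ^ 2" using that exp_of_nat_mult[of 2 "ln (real n)"] by simp
    also have "\<dots> \<le> real N ^ 2" using that by (intro power_mono) auto
    finally show ?thesis .
  qed
  hence "norm (zeta_resonator N s) \<le> (\<Sum>n\<in>{1..N}. real N ^ 2)"
    unfolding zeta_resonator_def by (rule sum_norm_le)
  thus ?thesis by (simp add: power3_eq_cube power2_eq_square)
qed

text \<open>
  Here $\zeta(s) \sum_n n^{s - 1/2} = \sum_{n, m} n^{-1/2} (n/m)^s$ is integrated termwise: the diagonal
  contributes the main term, and the off-diagonal terms are explicit primitives.
\<close>

lemma zeta_resonator_right_line:
  fixes G :: "complex \<Rightarrow> complex" and a b :: real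
  assumes ab: "a \<le> b" and G: "\<And>s. s \<in> closed_segment (Complex 2 a) (Complex 2 b) \<Longrightarrow>
      (G has_field_derivative zeta s * zeta_resonator N s) (at s)"
  defines "S \<equiv> \<Sum>n\<in>{1..N}. exp (- ln (real n) / 2)"
  shows "norm (G (Complex 2 b) - G (Complex 2 a) - of_real (S * (b - a)) * \<i>) \<le> 8 * real N ^ 4"
proof -
  define L where "L = (\<lambda>n. ln (real n))"
  define e where "e = (\<lambda>n m s. exp ((s - 1 / 2) * of_real (L n) - s * of_real (L m)) :: complex)"
  define tail where "tail = (\<lambda>M. \<Sum>m. 1 / (real (m + M) + 1)\<^sup>2)"
  have sq_sums: "(\<lambda>m. 1 / (real m + 1)\<^sup>2) sums (pi\<^sup>2 / 6)"
    using inverse_squares_sums by (simp add: add.commute)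
  hence sq: "summable (\<lambda>m. 1 / (real m + 1)\<^sup>2)" by (rule sums_summable)
  define Z where "Z = closed_segment (Complex 2 a) (Complex 2 b)"
  have ReZ: "Re s = 2" if "s \<in> Z" for s
    using that by (auto simp: Z_def in_segment)
  \<comment> \<open>For Re s = 2 the numerator has modulus n^(3/2) m^(-2), with 3/2 rounded up to 2
    to keep integer powers; the remaining 2n comes from the logarithmic denominator.\<close>
  have off: "norm (e n m s / of_real (L n - L m)) \<le> 2 * real n ^ 3 * (1 / (real m)\<^sup>2)"
    if "n \<ge> 1" "m \<ge> 1" "n \<noteq> m" "Re s = 2" for n m s
  proof -
    have "norm (e n m s) = exp (3 / 2 * L n - 2 * L m)" using that by (simp add: e_def)
    also have "\<dots> \<le> exp (2 * L n - 2 * L m)" using that by (simp add: L_def)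
    also have "\<dots> = (real n)\<^sup>2 / (real m)\<^sup>2"
      using that exp_of_nat_mult[of 2 "L n"] exp_of_nat_mult[of 2 "L m"]
      by (simp add: exp_diff L_def)
    finally have 1: "norm (e n m s) \<le> (real n)\<^sup>2 / (real m)\<^sup>2" .
    have "norm (e n m s / of_real (L n - L m)) = norm (e n m s) / \<bar>L n - L m\<bar>"
      by (simp add: norm_divide flip: of_real_diff)
    also have "\<dots> \<le> ((real n)\<^sup>2 / (real m)\<^sup>2) / (1 / (2 * real n))"
      using 1 ln_diff_lower_bound[of n m] that by (intro frac_le) (auto simp: L_def)
    also have "\<dots> = 2 * real n ^ 3 * (1 / (real m)\<^sup>2)"
      by (simp add: power2_eq_square power3_eq_cube)
    finally show ?thesis .
  qed
  define H where "H = (\<lambda>M s. \<Sum>n\<in>{1..N}. \<Sum>m\<in>{1..M} - {n}. e n m s / of_real (L n - L m))"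
  have H_le: "norm (H M s) \<le> 4 * real N ^ 4" if "Re s = 2" for M s
  proof -
    have "norm (\<Sum>m\<in>{1..M} - {n}. e n m s / of_real (L n - L m)) \<le> 4 * real N ^ 3"
      if n: "n \<in> {1..N}" for n
    proof -
      have "norm (\<Sum>m\<in>{1..M} - {n}. e n m s / of_real (L n - L m))
          \<le> (\<Sum>m\<in>{1..M} - {n}. 2 * real n ^ 3 * (1 / (real m)\<^sup>2))"
        by (intro sum_norm_le off) (use n \<open>Re s = 2\<close> in auto)
      also have "\<dots> = 2 * real n ^ 3 * (\<Sum>m\<in>{1..M} - {n}. 1 / (real m)\<^sup>2)"
        by (rule sum_distrib_left[symmetric])
      also have "(\<Sum>m\<in>{1..M} - {n}. 1 / (real m)\<^sup>2) \<le> (\<Sum>m\<in>{1..M}. 1 / (real m)\<^sup>2)"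
        by (intro sum_mono2) auto
      also have "(\<Sum>m\<in>{1..M}. 1 / (real m)\<^sup>2) = (\<Sum>m<M. 1 / (real m + 1)\<^sup>2)"
        by (rule sum.reindex_bij_witness[of _ Suc "\<lambda>m. m - 1"]) (auto simp: algebra_simps of_nat_diff)
      also have "\<dots> \<le> pi\<^sup>2 / 6" unfolding sums_unique[OF sq_sums] by (intro sum_le_suminf sq) auto
      also have "\<dots> \<le> 2" using pi_squared_bound by simp
      also have "2 * real n ^ 3 * 2 \<le> 2 * real N ^ 3 * 2"
        using n by (intro mult_right_mono mult_left_mono power_mono) auto
      finally show ?thesis by (simp add: mult_left_mono)
    qed
    hence "norm (H M s) \<le> (\<Sum>n\<in>{1..N}. 4 * real N ^ 3)" unfolding H_def by (rule sum_norm_le)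
    thus ?thesis by (simp add: eval_nat_numeral)
  qed
  have tail_le: "norm (zeta s - (\<Sum>m\<in>{1..M}. exp (- s * of_real (L m)))) \<le> tail M" if "Re s = 2" for s M
  proof -
    have "(\<lambda>m. 1 / of_nat (Suc m) powr s) sums zeta s" by (rule zeta_sums) (use that in auto)
    from sums_split_initial_segment[OF this, of M]
    have 1: "(\<lambda>m. 1 / of_nat (Suc (m + M)) powr s) sums (zeta s - (\<Sum>m<M. 1 / of_nat (Suc m) powr s))" .
    have "(\<Sum>m<M. 1 / of_nat (Suc m) powr s) = (\<Sum>m\<in>{1..M}. exp (- s * of_real (L m)))"
      unfolding zeta_term_eq_exp L_def
      by (rule sum.reindex_bij_witness[of _ "\<lambda>m. m - 1" Suc]) auto
    with 1 have "zeta s - (\<Sum>m\<in>{1..M}. exp (- s * of_real (L m))) = (\<Sum>m. 1 / of_nat (Suc (m + M)) powr s)"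
      by (simp add: sums_iff)
    moreover have "norm (\<Sum>m. 1 / of_nat (Suc (m + M)) powr s) \<le> tail M" unfolding tail_def
    proof (rule norm_suminf_le)
      show "summable (\<lambda>m. 1 / (real (m + M) + 1)\<^sup>2)"
        using summable_ignore_initial_segment[OF sq, of M] .
      show "norm (1 / of_nat (Suc (m + M)) powr s) \<le> 1 / (real (m + M) + 1)\<^sup>2" for m
        unfolding norm_zeta_term using that by (simp add: powr_minus powr_numeral field_simps)
    qed
    ultimately show ?thesis by simp
  qed
  \<comment> \<open>Truncating the series of \<zeta> at M makes the primitive H of the off-diagonal
    terms a finite sum; M >= N gives every n its diagonal partner m = n. Subtracting S s and H from
    G leaves a function whose derivative is the tail of \<zeta> times the resonator, and this error
    vanishes as M grows.\<close>
  have main: "norm (G (Complex 2 b) - G (Complex 2 a) - of_real (S * (b - a)) * \<i>)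
      \<le> 8 * real N ^ 4 + tail M * real N ^ 3 * (b - a)" if "M \<ge> N" for M
  proof -
    define D where "D = (\<lambda>s. G s - of_real S * s - H M s)"
    have "norm (D (Complex 2 b) - D (Complex 2 a)) \<le> (tail M * real N ^ 3) * norm (Complex 2 b - Complex 2 a)"
    proof (rule field_differentiable_bound)
      show "convex Z" "Complex 2 a \<in> Z" "Complex 2 b \<in> Z" by (auto simp: Z_def)
      define D' where "D' = (\<lambda>s. (zeta s - (\<Sum>m\<in>{1..M}. exp (- s * of_real (L m)))) * zeta_resonator N s)"
      fix s assume s: "s \<in> Z"
      have "(H M has_field_derivative (\<Sum>n\<in>{1..N}. \<Sum>m\<in>{1..M} - {n}. e n m s)) (at s)"
        unfolding H_def
      proof (intro DERIV_sum)
        fix n m assume "n \<in> {1..N}" "m \<in> {1..M} - {n}"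
        hence "\<bar>L n - L m\<bar> \<ge> 1 / (2 * real n)" "n \<ge> 1"
          using ln_diff_lower_bound[of n m] by (auto simp: L_def)
        hence "L n - L m \<noteq> 0" by auto
        hence nz: "complex_of_real (L n - L m) \<noteq> 0" using of_real_eq_0_iff by blast
        have "(e n m has_field_derivative e n m s * of_real (L n - L m)) (at s)"
          unfolding e_def by (auto intro!: derivative_eq_intros simp: algebra_simps)
        from DERIV_cdivide[OF this, of "of_real (L n - L m)"]
        show "((\<lambda>s. e n m s / of_real (L n - L m)) has_field_derivative e n m s) (at s)"
          unfolding nonzero_mult_div_cancel_right[OF nz] .
      qed
      moreover have "(G has_field_derivative zeta s * zeta_resonator N s) (at s)"
        using G s by (simp add: Z_def)
      ultimately have "(D has_field_derivative (zeta s * zeta_resonator N s - of_real S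
            - (\<Sum>n\<in>{1..N}. \<Sum>m\<in>{1..M} - {n}. e n m s))) (at s)"
        unfolding D_def by (auto intro!: derivative_eq_intros)
      also have "zeta s * zeta_resonator N s - of_real S - (\<Sum>n\<in>{1..N}. \<Sum>m\<in>{1..M} - {n}. e n m s) = D' s"
      proof -
        have "of_real S + (\<Sum>n\<in>{1..N}. \<Sum>m\<in>{1..M} - {n}. e n m s) = (\<Sum>n\<in>{1..N}. e n n s + (\<Sum>m\<in>{1..M} - {n}. e n m s))"
        proof -
          have "e n n s = of_real (exp (- ln (real n) / 2))" for n
          proof -
            have "(s - 1 / 2) * of_real (L n) - s * of_real (L n) = of_real (- ln (real n) / 2)"
              by (simp add: L_def algebra_simps)
            thus ?thesis unfolding e_def by (simp only: exp_of_real)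
          qed
          thus ?thesis by (simp only: S_def sum.distrib of_real_sum)
        qed
        also have "\<dots> = (\<Sum>n\<in>{1..N}. \<Sum>m\<in>{1..M}. e n m s)"
          using \<open>M \<ge> N\<close> by (intro sum.cong refl sum.remove[symmetric]) auto
        also have "\<dots> = (\<Sum>n\<in>{1..N}. \<Sum>m\<in>{1..M}. exp (- s * of_real (L m)) * exp ((s - 1 / 2) * of_real (L n)))"
          by (simp add: e_def algebra_simps flip: exp_add)
        also have "\<dots> = (\<Sum>m\<in>{1..M}. exp (- s * of_real (L m))) * zeta_resonator N s"
          unfolding zeta_resonator_def sum_product L_def by (rule sum.swap)
        finally show ?thesis by (simp add: D'_def algebra_simps)
      qed
      finally show "(D has_field_derivative D' s) (at s within Z)" by (rule has_field_derivative_at_within)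
      show "norm (D' s) \<le> tail M * real N ^ 3"
        unfolding D'_def norm_mult using ReZ[OF s]
        by (intro mult_mono tail_le norm_zeta_resonator_le) (auto intro: order_trans[OF norm_ge_zero tail_le])
    qed
    moreover have "norm (Complex 2 b - Complex 2 a) = b - a" using ab by (simp add: cmod_def)
    moreover have "norm (H M (Complex 2 b) - H M (Complex 2 a)) \<le> 4 * real N ^ 4 + 4 * real N ^ 4"
      by (intro order_trans[OF norm_triangle_ineq4] add_mono H_le) auto
    moreover have "G (Complex 2 b) - G (Complex 2 a) - of_real (S * (b - a)) * \<i>
       = (D (Complex 2 b) - D (Complex 2 a)) + (H M (Complex 2 b) - H M (Complex 2 a))"
      by (simp add: D_def Complex_eq algebra_simps)
    ultimately show ?thesis
      using norm_triangle_ineq[of "D (Complex 2 b) - D (Complex 2 a)" "H M (Complex 2 b) - H M (Complex 2 a)"]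
      by (simp add: mult_ac)
  qed
  have "tail \<longlonglongrightarrow> 0" unfolding tail_def using suminf_exist_split2[OF sq] by simp
  hence "(\<lambda>M. 8 * real N ^ 4 + tail M * real N ^ 3 * (b - a)) \<longlonglongrightarrow> 8 * real N ^ 4 + 0 * real N ^ 3 * (b - a)"
    by (intro tendsto_intros)
  thus ?thesis using main by (intro LIMSEQ_le_const[of _ "8 * real N ^ 4"]) auto
qed

text \<open>In this real form the off-diagonal terms have explicit sine primitives.\<close>

lemma norm_zeta_resonator_squared:
  "(norm (zeta_resonator N (Complex (1 / 4) t)))\<^sup>2 =
     (\<Sum>n\<in>{1..N}. \<Sum>m\<in>{1..N}. exp (- (ln (real n) + ln (real m)) / 4) * cos (t * (ln (real n) - ln (real m))))"
proof -
  define L where "L = (\<lambda>n. ln (real n))"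
  define Q where "Q = zeta_resonator N (Complex (1 / 4) t)"
  have Q: "Q = (\<Sum>n\<in>{1..N}. exp (Complex (- L n / 4) (t * L n)))"
    unfolding Q_def zeta_resonator_def L_def
    by (intro sum.cong refl arg_cong[of _ _ exp]) (simp add: complex_eq_iff)
  have "(norm Q)\<^sup>2 = Re (Q * cnj Q)" by (simp add: complex_mult_cnj cmod_power2)
  also have "Q * cnj Q = (\<Sum>n\<in>{1..N}. \<Sum>m\<in>{1..N}. exp (Complex (- (L n + L m) / 4) (t * (L n - L m))))"
    unfolding Q cnj_sum sum_product
  proof (intro sum.cong refl)
    fix n m
    have "exp (Complex (- L n / 4) (t * L n)) * cnj (exp (Complex (- L m / 4) (t * L m)))
       = exp (Complex (- L n / 4) (t * L n) + cnj (Complex (- L m / 4) (t * L m)))"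
      unfolding exp_add exp_cnj by simp
    also have "Complex (- L n / 4) (t * L n) + cnj (Complex (- L m / 4) (t * L m)) = Complex (- (L n + L m) / 4) (t * (L n - L m))"
      by (simp add: complex_eq_iff field_simps)
    finally show "exp (Complex (- L n / 4) (t * L n)) * cnj (exp (Complex (- L m / 4) (t * L m)))
       = exp (Complex (- (L n + L m) / 4) (t * (L n - L m)))" .
  qed
  finally show ?thesis by (simp add: Q_def L_def Re_exp)
qed

text \<open>
  With $Q$ the resonator, $|\zeta - \overline{Q}|^2 \ge 0$ gives $|\zeta|^2 \ge 2 \mathrm{Re}(\zeta Q) - |Q|^2$ pointwise on the
  line of real part $1/4$. The mean value theorem for a primitive of the right-hand side
  avoids integrals.
\<close>

lemma zeta_mean_square_lower_bound:
  fixes a b B :: real and N :: nat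
  assumes a: "1 \<le> a" "a < b"
    and B: "\<And>s. 1 / 4 \<le> Re s \<Longrightarrow> Re s \<le> 2 \<Longrightarrow> a \<le> Im s \<Longrightarrow> Im s \<le> b \<Longrightarrow> norm (zeta s) \<le> B"
  shows "(b - a) * sqrt (real N) \<le> (b - a) * B\<^sup>2 + 20 * real N ^ 4 + 8 * B * real N ^ 3"
proof -
  define L where "L = (\<lambda>n. ln (real n))"
  define c where "c = (\<lambda>n m. exp (- (L n + L m) / 4))"
  define S where "S = (\<Sum>n\<in>{1..N}. exp (- ln (real n) / 2))"
  \<comment> \<open>The upper half-plane is convex and avoids the pole, so a single primitive G of
    \<zeta> times the resonator serves all sides of the rectangle.\<close>
  define U where "U = {s :: complex. Im s > 0}"
  have B0: "0 \<le> B" using B[of "Complex 1 a"] a by (auto intro: order_trans[OF norm_ge_zero])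
  have U: "convex U" "open U" unfolding U_def by (rule convex_halfspace_Im_gt open_halfspace_Im_gt)+
  have "(\<lambda>s. zeta s * zeta_resonator N s) holomorphic_on U"
    unfolding zeta_resonator_def
    by (intro holomorphic_intros holomorphic_on_subset[OF holomorphic_zeta]) (auto simp: U_def)
  from holomorphic_convex_primitive'[OF U this] obtain G where
    G_within: "\<And>s. s \<in> U \<Longrightarrow> (G has_field_derivative zeta s * zeta_resonator N s) (at s within U)" by blast
  have G: "(G has_field_derivative zeta s * zeta_resonator N s) (at s)" if "Im s > 0" for s
    using G_within[of s] at_within_open[OF _ U(2), of s] that by (simp add: U_def)

  have horizontal: "norm (G (Complex (1 / 4) y) - G (Complex 2 y)) \<le> 2 * B * real N ^ 3"
    if y: "a \<le> y" "y \<le> b" for y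
  proof -
    define Z where "Z = closed_segment (Complex (1 / 4) y) (Complex 2 y)"
    have Z: "1 / 4 \<le> Re s" "Re s \<le> 2" "Im s = y" if s: "s \<in> Z" for s
    proof -
      obtain u where u: "0 \<le> u" "u \<le> 1" "s = (1 - u) *\<^sub>R Complex (1 / 4) y + u *\<^sub>R Complex 2 y"
        using s by (auto simp: Z_def in_segment)
      show "1 / 4 \<le> Re s" "Re s \<le> 2" "Im s = y"
        unfolding u(3) using u(1,2) by (auto simp: algebra_simps)
    qed
    have "norm (G (Complex (1 / 4) y) - G (Complex 2 y)) \<le> B * real N ^ 3 * norm (Complex (1 / 4) y - Complex 2 y)"
    proof (rule field_differentiable_bound)
      show "convex Z" "Complex (1 / 4) y \<in> Z" "Complex 2 y \<in> Z" by (auto simp: Z_def)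
      fix s assume s: "s \<in> Z"
      show "(G has_field_derivative zeta s * zeta_resonator N s) (at s within Z)"
        by (rule has_field_derivative_at_within[OF G]) (use Z[OF s] y a in auto)
      show "norm (zeta s * zeta_resonator N s) \<le> B * real N ^ 3"
        unfolding norm_mult using Z[OF s] y B0 by (intro mult_mono B norm_zeta_resonator_le) auto
    qed
    also have "\<dots> \<le> B * real N ^ 3 * 2" using B0 by (intro mult_left_mono) (auto simp: cmod_def)
    finally show ?thesis by (simp add: mult_ac)
  qed
  have vertical: "norm (G (Complex 2 b) - G (Complex 2 a) - of_real (S * (b - a)) * \<i>) \<le> 8 * real N ^ 4"
    unfolding S_def
  proof (rule zeta_resonator_right_line)
    fix s assume "s \<in> closed_segment (Complex 2 a) (Complex 2 b)"
    then obtain u where u: "0 \<le> u" "u \<le> 1" "s = (1 - u) *\<^sub>R Complex 2 a + u *\<^sub>R Complex 2 b"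
      by (auto simp: in_segment)
    have "Im s = a + u * (b - a)" unfolding u(3) by (simp add: algebra_simps)
    moreover have "0 \<le> u * (b - a)" using u a by simp
    ultimately show "(G has_field_derivative zeta s * zeta_resonator N s) (at s)" using a by (intro G) simp
  qed (use a in simp)
  define Err where "Err = 8 * real N ^ 4 + 4 * B * real N ^ 3"
  \<comment> \<open>Moving from Re s = 2 to Re s = 1/4 is telescoping of values of G: the two
    horizontal sides cost 2 B N^3 each, the right side 8 N^4.\<close>
  have left: "S * (b - a) - Err \<le> Im (G (Complex (1 / 4) b)) - Im (G (Complex (1 / 4) a))"
  proof -
    define X where "X = G (Complex 2 b) - G (Complex 2 a) - of_real (S * (b - a)) * \<i>"
    define Y where "Y = (\<lambda>y. G (Complex (1 / 4) y) - G (Complex 2 y))"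
    have "G (Complex (1 / 4) b) - G (Complex (1 / 4) a) - of_real (S * (b - a)) * \<i> = X + Y b - Y a"
      by (simp add: X_def Y_def)
    hence "Im (G (Complex (1 / 4) b)) - Im (G (Complex (1 / 4) a)) - S * (b - a) = Im X + Im (Y b) - Im (Y a)"
      by (simp add: complex_eq_iff)
    moreover have "\<bar>Im X\<bar> \<le> 8 * real N ^ 4" "\<bar>Im (Y b)\<bar> \<le> 2 * B * real N ^ 3" "\<bar>Im (Y a)\<bar> \<le> 2 * B * real N ^ 3"
      using order_trans[OF abs_Im_le_cmod vertical] order_trans[OF abs_Im_le_cmod horizontal] a
      unfolding X_def Y_def by auto
    ultimately show ?thesis by (simp add: Err_def)
  qed

  define P where "P = (\<lambda>t. \<Sum>n\<in>{1..N}. c n n * t + (\<Sum>m\<in>{1..N} - {n}. c n m * (sin (t * (L n - L m)) / (L n - L m))))"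
  have P_deriv: "(P has_real_derivative (norm (zeta_resonator N (Complex (1 / 4) t)))\<^sup>2) (at t)" for t
  proof -
    have "(P has_real_derivative (\<Sum>n\<in>{1..N}. c n n + (\<Sum>m\<in>{1..N} - {n}. c n m * cos (t * (L n - L m))))) (at t)"
      unfolding P_def
    proof (intro DERIV_sum DERIV_add)
      show "((*) (c n n) has_real_derivative c n n) (at t)" for n
        by (auto intro!: derivative_eq_intros)
      fix n m assume "n \<in> {1..N}" "m \<in> {1..N} - {n}"
      hence "\<bar>L n - L m\<bar> \<ge> 1 / (2 * real n)" "n \<ge> 1"
        using ln_diff_lower_bound[of n m] by (auto simp: L_def)
      hence "L n - L m \<noteq> 0" by auto
      thus "((\<lambda>t. c n m * (sin (t * (L n - L m)) / (L n - L m))) has_real_derivative c n m * cos (t * (L n - L m))) (at t)"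
        by (auto intro!: derivative_eq_intros)
    qed
    also have "(\<Sum>n\<in>{1..N}. c n n + (\<Sum>m\<in>{1..N} - {n}. c n m * cos (t * (L n - L m))))
        = (\<Sum>n\<in>{1..N}. \<Sum>m\<in>{1..N}. c n m * cos (t * (L n - L m)))"
      by (intro sum.cong refl, subst sum.remove[of "{1..N}"]) auto
    also have "\<dots> = (norm (zeta_resonator N (Complex (1 / 4) t)))\<^sup>2"
      unfolding norm_zeta_resonator_squared by (simp add: c_def L_def)
    finally show ?thesis .
  qed
  \<comment> \<open>The diagonal of |Q|^2 gives the same S as that of \<zeta> Q, since n^(-1/4)
    squared is n^(-1/2). Hence one S survives in 2 Re (\<zeta> Q) - |Q|^2.\<close>
  have P_diff: "P b - P a \<le> S * (b - a) + 4 * real N ^ 3"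
  proof -
    define W where "W = (\<lambda>t. \<Sum>n\<in>{1..N}. \<Sum>m\<in>{1..N} - {n}. c n m * (sin (t * (L n - L m)) / (L n - L m)))"
    have P_eq: "P t = S * t + W t" for t
    proof -
      have "c n n = exp (- ln (real n) / 2)" for n by (simp add: c_def L_def)
      thus ?thesis by (simp add: P_def S_def W_def sum.distrib sum_distrib_right)
    qed
    have W_le: "\<bar>W t\<bar> \<le> 2 * real N ^ 3" for t
    proof -
      have "\<bar>\<Sum>m\<in>{1..N} - {n}. c n m * (sin (t * (L n - L m)) / (L n - L m))\<bar> \<le> 2 * real N ^ 2"
        if n: "n \<in> {1..N}" for n
      proof -
        have "\<bar>c n m * (sin (t * (L n - L m)) / (L n - L m))\<bar> \<le> 2 * real N" if m: "m \<in> {1..N} - {n}" for m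
        proof -
          have "0 \<le> L n" "0 \<le> L m" using n m by (auto simp: L_def)
          hence "c n m \<le> 1" "0 \<le> c n m" by (auto simp: c_def)
          moreover have "1 / (2 * real N) \<le> \<bar>L n - L m\<bar>"
          proof -
            have "1 / (2 * real N) \<le> 1 / (2 * real n)" using n by (simp add: frac_le)
            also have "\<dots> \<le> \<bar>L n - L m\<bar>" unfolding L_def by (rule ln_diff_lower_bound) (use n m in auto)
            finally show ?thesis .
          qed
          hence "\<bar>sin (t * (L n - L m))\<bar> / \<bar>L n - L m\<bar> \<le> 1 / (1 / (2 * real N))"
            using n by (intro frac_le) auto
          ultimately have "c n m * (\<bar>sin (t * (L n - L m))\<bar> / \<bar>L n - L m\<bar>) \<le> 1 * (2 * real N)"
            by (intro mult_mono) auto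
          thus ?thesis using \<open>0 \<le> c n m\<close> by (simp add: abs_mult)
        qed
        hence "\<bar>\<Sum>m\<in>{1..N} - {n}. c n m * (sin (t * (L n - L m)) / (L n - L m))\<bar> \<le> (\<Sum>m\<in>{1..N} - {n}. 2 * real N)"
          by (intro order_trans[OF sum_abs] sum_mono)
        also have "\<dots> \<le> (\<Sum>m\<in>{1..N}. 2 * real N)" by (intro sum_mono2) auto
        finally show ?thesis by (simp add: power2_eq_square)
      qed
      hence "\<bar>W t\<bar> \<le> (\<Sum>n\<in>{1..N}. 2 * real N ^ 2)"
        unfolding W_def by (rule order_trans[OF sum_abs sum_mono])
      thus ?thesis by (simp add: power2_eq_square power3_eq_cube)
    qed
    show ?thesis using W_le[of a] W_le[of b] by (simp add: P_eq algebra_simps)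
  qed

  define \<Phi> where "\<Phi> = (\<lambda>t. 2 * Im (G (Complex (1 / 4) t)) - P t)"
  define \<Phi>' where "\<Phi>' = (\<lambda>t. 2 * Re (zeta (Complex (1 / 4) t) * zeta_resonator N (Complex (1 / 4) t))
      - (norm (zeta_resonator N (Complex (1 / 4) t)))\<^sup>2)"
  have \<Phi>: "(\<Phi> has_real_derivative \<Phi>' t) (at t)" if "t > 0" for t
  proof -
    have "((\<lambda>t. G (Complex (1 / 4) t)) has_vector_derivative
        \<i> * (zeta (Complex (1 / 4) t) * zeta_resonator N (Complex (1 / 4) t))) (at t)"
    proof -
      have "((\<lambda>t. Complex (1 / 4) t) has_vector_derivative \<i>) (at t)"
        unfolding Complex_eq by (auto intro!: derivative_eq_intros)
      from field_vector_diff_chain_at[OF this G[of "Complex (1 / 4) t"]] that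
      show ?thesis by (simp add: o_def)
    qed
    from has_field_derivative_Im[OF this]
    have "((\<lambda>t. Im (G (Complex (1 / 4) t))) has_real_derivative
        Re (zeta (Complex (1 / 4) t) * zeta_resonator N (Complex (1 / 4) t))) (at t)"
      by simp
    from DERIV_diff[OF DERIV_cmult[OF this, of 2] P_deriv[of t]]
    show ?thesis by (simp add: \<Phi>_def \<Phi>'_def)
  qed
  have "\<Phi>' t \<le> B\<^sup>2" if t: "a \<le> t" "t \<le> b" for t
  proof -
    define z where "z = zeta (Complex (1 / 4) t)"
    define q where "q = zeta_resonator N (Complex (1 / 4) t)"
    have "0 \<le> (norm (z - cnj q))\<^sup>2" by simp
    also have "(norm (z - cnj q))\<^sup>2 = (norm z)\<^sup>2 - (2 * Re (z * q) - (norm q)\<^sup>2)"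
      unfolding cmod_power2 by (simp add: power2_eq_square algebra_simps)
    also have "(norm z)\<^sup>2 \<le> B\<^sup>2" unfolding z_def using t a by (intro power_mono B) auto
    finally show ?thesis by (simp add: \<Phi>'_def z_def q_def)
  qed
  moreover obtain t where "a < t" "t < b" "\<Phi> b - \<Phi> a = (b - a) * \<Phi>' t"
    using MVT2[OF a(2), of \<Phi> \<Phi>'] \<Phi> a by force
  ultimately have "\<Phi> b - \<Phi> a \<le> (b - a) * B\<^sup>2" using a by simp
  moreover have "\<Phi> b - \<Phi> a = 2 * (Im (G (Complex (1 / 4) b)) - Im (G (Complex (1 / 4) a))) - (P b - P a)"
    by (simp add: \<Phi>_def)
  \<comment> \<open>Stated for plain variables, so that the linear arithmetic is done apart from the
    large terms.\<close>
  moreover have "v \<le> x + 2 * e + y" if "f \<le> x" "f = 2 * g - p" "v - e \<le> g" "p \<le> v + y" for v e f g p x y :: real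
    using that by linarith
  ultimately have 1: "S * (b - a) \<le> (b - a) * B\<^sup>2 + 2 * Err + 4 * real N ^ 3"
    using left P_diff by blast
  \<comment> \<open>Each of the N summands is at least N^(-1/2).\<close>
  have "sqrt (real N) \<le> S"
  proof (cases "N = 0")
    case False
    have "exp (- ln (real N) / 2) \<le> exp (- ln (real n) / 2)" if "n \<in> {1..N}" for n
      using that by auto
    hence "(\<Sum>n\<in>{1..N}. exp (- ln (real N) / 2)) \<le> S" unfolding S_def by (rule sum_mono)
    moreover have "exp (- ln (real N) / 2) = 1 / sqrt (real N)"
    proof -
      have "exp (- ln (real N) / 2) = inverse (exp (ln (sqrt (real N))))"
        using False by (subst exp_minus[symmetric]) (simp add: ln_sqrt)
      thus ?thesis using False by (simp add: inverse_eq_divide)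
    qed
    ultimately show ?thesis using False by (simp add: real_div_sqrt)
  qed (simp add: S_def)
  hence "(b - a) * sqrt (real N) \<le> S * (b - a)" using a by (simp add: mult.commute)
  \<comment> \<open>Merges 2 * 8 N^4 and 4 N^3 into 20 N^4.\<close>
  moreover have "real N ^ 3 \<le> real N ^ 4" by (cases N) (auto intro: power_increasing)
  ultimately show ?thesis using 1 by (simp add: Err_def)
qed

text \<open>The hypothesis and nonvanishing on Re s >= 1 turn absence of zeros on the line into
  absence for Re s > 1/8. The mean square is taken over the middle part [2T, 3T], so that the window
  of height 3 around each point stays inside [T, 4T].\<close>

lemma RH_zeta_zero_in_interval:
  assumes RH: "Riemann_hypothesis"
  obtains T\<^sub>0 where "\<And>T. T \<ge> T\<^sub>0 \<Longrightarrow> \<exists>\<gamma>. T \<le> \<gamma> \<and> \<gamma> \<le> 4 * T \<and> zeta (1 / 2 + \<i> * of_real \<gamma>) = 0"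
proof -
  obtain T1 where T1: "T1 \<ge> 9"
    "\<And>s. Im s \<ge> T1 \<Longrightarrow> 1 / 8 + 1 / 8 \<le> Re s \<Longrightarrow> Re s \<le> 3 \<Longrightarrow>
       (\<And>z. 1 / 8 < Re z \<Longrightarrow> \<bar>Im z - Im s\<bar> < 3 \<Longrightarrow> zeta z \<noteq> 0) \<Longrightarrow> norm (zeta s) \<le> Im s powr (1 / 100)"
    by (rule zeta_subpolynomial_zero_free[of "1 / 8" "1 / 8" "1 / 100"]) auto
  \<comment> \<open>With B = T^(2/100) and N about T^(1/5), the terms on the left have orders
    T^(26/25), T^(4/5) and T^(31/50), against T^(11/10) on the right. The -1 accounts for the floor
    in N.\<close>
  have "eventually (\<lambda>T::real. T * (T powr (2 / 100))\<^sup>2 + 20 * (T powr (1 / 5)) ^ 4 + 8 * T powr (2 / 100) * (T powr (1 / 5)) ^ 3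
      < T * sqrt (T powr (1 / 5) - 1)) at_top"
    by real_asymp
  then obtain T2 where T2: "\<And>T. T \<ge> T2 \<Longrightarrow> T * (T powr (2 / 100))\<^sup>2 + 20 * (T powr (1 / 5)) ^ 4 + 8 * T powr (2 / 100) * (T powr (1 / 5)) ^ 3
      < T * sqrt (T powr (1 / 5) - 1)"
    unfolding eventually_at_top_linorder by blast
  show ?thesis
  proof (rule that[of "max T1 T2"], rule ccontr)
    fix T assume T: "max T1 T2 \<le> T"
      and none: "\<nexists>\<gamma>. T \<le> \<gamma> \<and> \<gamma> \<le> 4 * T \<and> zeta (1 / 2 + \<i> * of_real \<gamma>) = 0"
    have T9: "T \<ge> 9" using T T1 by simp
    have nz: "zeta z \<noteq> 0" if z: "1 / 8 < Re z" "T \<le> Im z" "Im z \<le> 4 * T" for z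
    proof
      assume zero: "zeta z = 0"
      have "Re z < 1" using zeta_nonzero_Re_ge_1[of z] zero z T9 by force
      hence "Re z = 1 / 2" using RH zero z unfolding Riemann_hypothesis_def by auto
      hence "z = 1 / 2 + \<i> * of_real (Im z)" by (simp add: complex_eq_iff)
      thus False using none zero z by metis
    qed
    define N where "N = nat \<lfloor>T powr (1 / 5)\<rfloor>"
    have N: "real N \<le> T powr (1 / 5)" "T powr (1 / 5) - 1 \<le> real N"
      unfolding N_def using powr_ge_zero[of T "1 / 5"] by linarith+
    have "(3 * T - 2 * T) * sqrt (real N) \<le> (3 * T - 2 * T) * (T powr (2 / 100))\<^sup>2
        + 20 * real N ^ 4 + 8 * T powr (2 / 100) * real N ^ 3"
    proof (rule zeta_mean_square_lower_bound)
      fix s assume s: "1 / 4 \<le> Re s" "Re s \<le> 2" "2 * T \<le> Im s" "Im s \<le> 3 * T"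
      have "norm (zeta s) \<le> Im s powr (1 / 100)"
      proof (rule T1(2))
        fix z assume "1 / 8 < Re z" "\<bar>Im z - Im s\<bar> < 3"
        thus "zeta z \<noteq> 0" using s T9 by (intro nz) (auto simp: abs_if split: if_splits)
      qed (use s T T9 in auto)
      also have "\<dots> \<le> (T * T) powr (1 / 100)"
      proof (rule powr_mono2)
        have "3 * T \<le> T * T" using T9 by simp
        thus "Im s \<le> T * T" using s by linarith
      qed (use s T9 in auto)
      also have "\<dots> = T powr (2 / 100)" using T9 by (simp add: powr_mult flip: powr_add)
      finally show "norm (zeta s) \<le> T powr (2 / 100)" .
    qed (use T9 in auto)
    also have "\<dots> \<le> T * (T powr (2 / 100))\<^sup>2 + 20 * (T powr (1 / 5)) ^ 4 + 8 * T powr (2 / 100) * (T powr (1 / 5)) ^ 3"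
      using N T9 by (intro add_mono mult_left_mono power_mono) auto
    also have "\<dots> < T * sqrt (T powr (1 / 5) - 1)" using T by (intro T2) auto
    also have "\<dots> \<le> T * sqrt (real N)" using N T9 by (intro mult_left_mono) auto
    finally show False by simp
  qed
qed

subsection \<open>Critical points of the Hardy function\<close>

lemma riemann_siegel_theta_has_derivative:
  obtains w where "(riemann_siegel_theta has_real_derivative w) (at t)"
proof -
  have "((\<lambda>t. 1 / 4 + \<i> * of_real t / 2) has_vector_derivative (\<i> / 2)) (at t)"
    by (auto intro!: derivative_eq_intros)
  moreover have "1 / 4 + \<i> * of_real t / 2 \<notin> \<real>\<^sub>\<le>\<^sub>0" by (auto simp: complex_nonpos_Reals_iff)
  ultimately have "((ln_Gamma \<circ> (\<lambda>t. 1 / 4 + \<i> * of_real t / 2)) has_vector_derivative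
      \<i> / 2 * Digamma (1 / 4 + \<i> * of_real t / 2)) (at t)"
    by (intro field_vector_diff_chain_at has_field_derivative_ln_Gamma_complex)
  from has_field_derivative_Im[OF this] obtain d where
    "((\<lambda>t. Im (ln_Gamma (1 / 4 + \<i> * of_real t / 2))) has_real_derivative d) (at t)"
    by (auto simp: o_def)
  hence "((\<lambda>t. Im (ln_Gamma (1 / 4 + \<i> * of_real t / 2)) - t / 2 * ln pi) has_real_derivative d - 1 / 2 * ln pi) (at t)"
    by (rule DERIV_diff) (auto intro!: derivative_eq_intros)
  thus ?thesis by (intro that) (simp add: riemann_siegel_theta_def[abs_def])
qed

text \<open>With w the derivative of theta, Z' = i exp(i theta) (\<zeta>' + w \<zeta>), and the
  exponential never vanishes. The point is that w is real.\<close>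

lemma hardy_Z_critical_point:
  assumes Z: "(hardy_Z has_vector_derivative 0) (at t)"
  obtains w :: real where "deriv zeta (1 / 2 + \<i> * of_real t) = - of_real w * zeta (1 / 2 + \<i> * of_real t)"
proof -
  define s where "s = 1 / 2 + \<i> * of_real t"
  obtain w where w: "(riemann_siegel_theta has_real_derivative w) (at t)"
    using riemann_siegel_theta_has_derivative by blast
  define E where "E = (\<lambda>t. exp (\<i> * of_real (riemann_siegel_theta t)))"
  have "((\<lambda>t. complex_of_real (riemann_siegel_theta t)) has_vector_derivative of_real w) (at t)"
    using w by (intro has_vector_derivative_of_real) (simp add: has_real_derivative_iff_has_vector_derivative)
  moreover have "((\<lambda>z. exp (\<i> * z)) has_field_derivative \<i> * E t) (at (of_real (riemann_siegel_theta t)))"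
    unfolding E_def by (auto intro!: derivative_eq_intros)
  ultimately have E: "(E has_vector_derivative of_real w * (\<i> * E t)) (at t)"
    using field_vector_diff_chain_at unfolding E_def by (fastforce simp: o_def)
  have "s \<noteq> 1" by (simp add: s_def complex_eq_iff)
  hence "(zeta has_field_derivative deriv zeta s) (at s)"
    by (intro holomorphic_derivI[OF holomorphic_zeta]) auto
  moreover have "((\<lambda>t. 1 / 2 + \<i> * of_real t) has_vector_derivative \<i>) (at t)"
    by (auto intro!: derivative_eq_intros)
  ultimately have "((\<lambda>t. zeta (1 / 2 + \<i> * of_real t)) has_vector_derivative \<i> * deriv zeta s) (at t)"
    using field_vector_diff_chain_at[of "\<lambda>t. 1 / 2 + \<i> * of_real t" \<i> t zeta] by (simp add: o_def s_def)
  from has_vector_derivative_mult[OF E this]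
  have "(hardy_Z has_vector_derivative E t * (\<i> * deriv zeta s) + of_real w * (\<i> * E t) * zeta s) (at t)"
    by (simp add: hardy_Z_def[abs_def] E_def s_def)
  from vector_derivative_unique_at[OF this Z]
  have "(\<i> * E t) * (deriv zeta s + of_real w * zeta s) = 0" by (simp add: algebra_simps)
  moreover have "\<i> * E t \<noteq> 0" by (simp add: E_def)
  ultimately have "deriv zeta s = - of_real w * zeta s" by (simp add: add_eq_0_iff)
  thus ?thesis unfolding s_def by (rule that)
qed

text \<open>Cauchy's inequality on discs of radius \<eta>/2 about points within \<eta>/2 of c bounds
  f'' by 2 M / (\<eta>/2)^2 = 8 M / \<eta>^2. The remainder in \<open>complex_Taylor\<close> is
  divided by \<open>fact 1\<close>, so no factor 1/2 appears.\<close>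

lemma Taylor_linear_bound:
  fixes f :: "complex \<Rightarrow> complex"
  assumes f: "f holomorphic_on ball c R" and r: "0 < \<eta>" "\<eta> < R"
    and M: "\<And>z. dist c z \<le> \<eta> \<Longrightarrow> norm (f z) \<le> M" and z: "dist c z \<le> \<eta> / 2"
  shows "norm (f z - (f c + deriv f c * (z - c))) \<le> 8 * M / \<eta>\<^sup>2 * (dist c z)\<^sup>2"
proof -
  define S where "S = cball c (\<eta> / 2)"
  have S: "S \<subseteq> ball c R" using r by (auto simp: S_def)
  have "norm ((deriv ^^ 0) f z - (\<Sum>i\<le>1. (deriv ^^ i) f c * (z - c) ^ i / fact i))
      \<le> 8 * M / \<eta>\<^sup>2 * norm (z - c) ^ Suc 1 / fact 1"
  proof (rule complex_Taylor[where S = S])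
    show "convex S" "c \<in> S" "z \<in> S" using r z by (auto simp: S_def)
    fix i x assume x: "x \<in> S"
    have "(deriv ^^ i) f holomorphic_on ball c R" by (rule holomorphic_higher_deriv[OF f open_ball])
    from holomorphic_derivI[OF this open_ball, of x]
    show "((deriv ^^ i) f has_field_derivative (deriv ^^ Suc i) f x) (at x within S)"
      using x S by (auto intro: has_field_derivative_at_within)
  next
    fix x assume x: "x \<in> S"
    have sub: "cball x (\<eta> / 2) \<subseteq> cball c \<eta>"
    proof
      fix u assume "u \<in> cball x (\<eta> / 2)"
      thus "u \<in> cball c \<eta>" using x dist_triangle[of c u x] by (simp add: S_def)
    qed
    hence sub': "cball x (\<eta> / 2) \<subseteq> ball c R" using r by auto
    have "norm ((deriv ^^ 2) f x) \<le> fact 2 * M / (\<eta> / 2) ^ 2"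
    proof (rule Cauchy_inequality)
      show "f holomorphic_on ball x (\<eta> / 2)"
        using f sub' ball_subset_cball holomorphic_on_subset by blast
      show "continuous_on (cball x (\<eta> / 2)) f"
        using f sub' holomorphic_on_imp_continuous_on holomorphic_on_subset by blast
      show "norm (f u) \<le> M" if "norm (x - u) = \<eta> / 2" for u
        using that sub by (intro M) (auto simp: dist_norm subset_iff)
    qed (use r in auto)
    thus "norm ((deriv ^^ Suc 1) f x) \<le> 8 * M / \<eta>\<^sup>2" by (simp add: power_divide numeral_2_eq_2)
  qed
  thus ?thesis by (simp add: dist_norm norm_minus_commute power2_eq_square)
qed

lemma zeta_critical_value_bound:
  assumes t: "1 < t" and \<eta>: "0 < \<eta>" "\<eta> \<le> 1 / 8"
    and M: "\<And>z. dist (1 / 2 + \<i> * of_real t) z \<le> \<eta> \<Longrightarrow> norm (zeta z) \<le> M"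
    and Z: "(hardy_Z has_vector_derivative 0) (at t)"
    and zero: "zeta (1 / 2 + \<i> * of_real \<gamma>) = 0" and near: "\<bar>\<gamma> - t\<bar> \<le> \<eta> / 2"
  shows "norm (zeta (1 / 2 + \<i> * of_real t)) \<le> 8 * M / \<eta>\<^sup>2 * (\<gamma> - t)\<^sup>2"
proof -
  define s where "s = 1 / 2 + \<i> * of_real t"
  define z where "z = 1 / 2 + \<i> * of_real \<gamma>"
  obtain w where w: "deriv zeta s = - of_real w * zeta s"
    using hardy_Z_critical_point[OF Z] unfolding s_def by blast
  have zs: "z - s = \<i> * of_real (\<gamma> - t)" by (simp add: z_def s_def algebra_simps)
  have dist: "dist s z = \<bar>\<gamma> - t\<bar>"
    unfolding dist_norm norm_minus_commute[of s z] zs norm_mult norm_of_real by simp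
  have "norm (zeta z - (zeta s + deriv zeta s * (z - s))) \<le> 8 * M / \<eta>\<^sup>2 * (dist s z)\<^sup>2"
  proof (rule Taylor_linear_bound[where R = 1])
    have "1 \<notin> ball s 1" using abs_Im_le_cmod[of "s - 1"] t by (auto simp: s_def dist_norm)
    thus "zeta holomorphic_on ball s 1" by (intro holomorphic_on_subset[OF holomorphic_zeta]) auto
  qed (use \<eta> near dist M in \<open>auto simp: s_def\<close>)
  \<comment> \<open>Since w is real and z - s purely imaginary, the second factor has real part
    exactly 1, hence modulus at least 1.\<close>
  also have "zeta z - (zeta s + deriv zeta s * (z - s)) = - (zeta s * Complex 1 (- w * (\<gamma> - t)))"
    using zero unfolding w zs by (simp add: z_def Complex_eq algebra_simps)
  finally have "norm (zeta s) * norm (Complex 1 (- w * (\<gamma> - t))) \<le> 8 * M / \<eta>\<^sup>2 * (\<gamma> - t)\<^sup>2"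
    by (simp add: norm_mult dist)
  moreover have "1 \<le> norm (Complex 1 (- w * (\<gamma> - t)))"
    using abs_Re_le_cmod[of "Complex 1 (- w * (\<gamma> - t))"] by simp
  ultimately show ?thesis
    using mult_left_mono[of 1 "norm (Complex 1 (- w * (\<gamma> - t)))" "norm (zeta s)"]
    by (simp add: s_def)
qed

theorem theorem1:
  fixes \<alpha> :: real and t \<gamma>\<^sub>1 \<gamma>\<^sub>2 :: "nat \<Rightarrow> real"
  assumes RH: "Riemann_hypothesis"
    and alpha: "0 < \<alpha>" "\<alpha> \<le> 1"
    and t_pos: "\<And>n. 0 < t n"
    and t_lim: "filterlim t at_top sequentially"
    and neighbors: "\<And>n. neighboring_ordinates (\<gamma>\<^sub>1 n) (\<gamma>\<^sub>2 n)"
    and between: "\<And>n. 0 < \<gamma>\<^sub>1 n" "\<And>n. \<gamma>\<^sub>1 n < t n" "\<And>n. t n < \<gamma>\<^sub>2 n"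
    and Z_deriv: "\<And>n. (hardy_Z has_vector_derivative 0) (at (t n))"
    and large: "\<And>n. norm (zeta (1 / 2 + \<i> * of_real (t n))) > 1 / t n powr \<alpha>"
  shows "\<exists>T. \<forall>n. t n > T \<longrightarrow> min (t n - \<gamma>\<^sub>1 n) (\<gamma>\<^sub>2 n - t n) > 1 / \<gamma>\<^sub>1 n powr \<alpha>"
proof -
  obtain \<eta> T1 where \<eta>: "0 < \<eta>" "\<eta> \<le> 1 / 8" and T1: "T1 \<ge> 9"
    "\<And>t s. t \<ge> T1 \<Longrightarrow> dist (1 / 2 + \<i> * of_real t) s \<le> \<eta> \<Longrightarrow> norm (zeta s) \<le> t powr (\<alpha> / 2)"
    using zeta_subpolynomial_critical_line[OF RH, of "\<alpha> / 2"] alpha by auto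
  obtain T0 where T0: "\<And>T. T \<ge> T0 \<Longrightarrow> \<exists>\<gamma>. T \<le> \<gamma> \<and> \<gamma> \<le> 4 * T \<and> zeta (1 / 2 + \<i> * of_real \<gamma>) = 0"
    using RH_zeta_zero_in_interval[OF RH] by blast
  \<comment> \<open>5 * T0 allows the zero-existence result at t/5; the last entry gives
    t^(\<alpha>/2) >= 200 / \<eta>^2. The threshold depends on \<alpha> only, not on the
    sequence.\<close>
  define T where "T = max (max T1 (5 * T0)) ((200 / \<eta>\<^sup>2) powr (2 / \<alpha>))"
  have "1 / \<gamma>\<^sub>1 n powr \<alpha> < \<bar>\<gamma> - t n\<bar>"
    if n: "t n > T" and \<gamma>: "\<gamma> = \<gamma>\<^sub>1 n \<or> \<gamma> = \<gamma>\<^sub>2 n" for n \<gamma>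
  proof (rule ccontr)
    assume "\<not> 1 / \<gamma>\<^sub>1 n powr \<alpha> < \<bar>\<gamma> - t n\<bar>"
    hence \<Delta>: "\<bar>\<gamma> - t n\<bar> \<le> 1 / \<gamma>\<^sub>1 n powr \<alpha>" by simp
    define X where "X = t n powr (\<alpha> / 2)"
    have t: "t n \<ge> T1" "t n / 5 \<ge> T0" "t n > 1" "(200 / \<eta>\<^sup>2) powr (2 / \<alpha>) \<le> t n"
      using n T1(1) by (auto simp: T_def)
    have X2: "t n powr \<alpha> = X\<^sup>2" by (simp add: X_def power2_eq_square flip: powr_add)
    have "((200 / \<eta>\<^sup>2) powr (2 / \<alpha>)) powr (\<alpha> / 2) \<le> X"
      unfolding X_def using t alpha by (intro powr_mono2) auto
    hence X: "200 / \<eta>\<^sup>2 \<le> X" using alpha \<eta> by (simp add: powr_powr)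
    have "\<eta>\<^sup>2 \<le> 1\<^sup>2" using \<eta> by (intro power_mono) auto
    hence "200 \<le> 200 / \<eta>\<^sup>2" using \<eta> by (simp add: field_simps)
    hence X1: "200 \<le> X" using X by simp
    \<comment> \<open>The interval [t/5, 4t/5] lies below t and so below the upper neighbour. A zero
      in it cannot exceed the lower neighbour, which is therefore at least t/5.\<close>
    obtain \<gamma>' where \<gamma>': "t n / 5 \<le> \<gamma>'" "\<gamma>' \<le> 4 * (t n / 5)" "zeta (1 / 2 + \<i> * of_real \<gamma>') = 0"
      using T0[OF t(2)] by blast
    have "t n / 5 \<le> \<gamma>\<^sub>1 n"
    proof (rule ccontr)
      assume "\<not> t n / 5 \<le> \<gamma>\<^sub>1 n"
      hence "\<gamma>\<^sub>1 n < \<gamma>'" "\<gamma>' < \<gamma>\<^sub>2 n" using \<gamma>' t between(3)[of n] by auto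
      thus False using neighbors[of n] \<gamma>'(3) unfolding neighboring_ordinates_def by blast
    qed
    hence "(t n / 5) powr \<alpha> \<le> \<gamma>\<^sub>1 n powr \<alpha>" using alpha t by (intro powr_mono2) auto
    hence "t n powr \<alpha> \<le> 5 powr \<alpha> * \<gamma>\<^sub>1 n powr \<alpha>" using t by (simp add: powr_divide field_simps)
    also have "\<dots> \<le> 5 powr 1 * \<gamma>\<^sub>1 n powr \<alpha>" using alpha by (intro mult_right_mono powr_mono) auto
    finally have "1 / \<gamma>\<^sub>1 n powr \<alpha> \<le> 5 / X\<^sup>2"
      using X1 between(1)[of n] by (simp add: X2 field_simps)
    with \<Delta> have \<Delta>': "\<bar>\<gamma> - t n\<bar> \<le> 5 / X\<^sup>2" by simp
    have "5 / X\<^sup>2 \<le> 5 / X" using X1 by (simp add: power2_eq_square field_simps)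
    also have "\<dots> \<le> 5 / (200 / \<eta>\<^sup>2)" using X X1 \<eta> by (intro divide_left_mono) auto
    also have "\<dots> \<le> \<eta> / 2" using \<eta> by (simp add: power2_eq_square)
    finally have near: "\<bar>\<gamma> - t n\<bar> \<le> \<eta> / 2" using \<Delta>' by simp
    have "1 / X\<^sup>2 < norm (zeta (1 / 2 + \<i> * of_real (t n)))" using large[of n] by (simp add: X2)
    also have "\<dots> \<le> 8 * X / \<eta>\<^sup>2 * (\<gamma> - t n)\<^sup>2"
    proof (rule zeta_critical_value_bound[OF t(3) \<eta> _ Z_deriv _ near])
      show "zeta (1 / 2 + \<i> * of_real \<gamma>) = 0"
        using neighbors[of n] \<gamma> by (auto simp: neighboring_ordinates_def)
      show "norm (zeta z) \<le> X" if "dist (1 / 2 + \<i> * of_real (t n)) z \<le> \<eta>" for z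
        unfolding X_def by (rule T1(2)[OF t(1) that])
    qed
    also have "\<dots> \<le> 8 * X / \<eta>\<^sup>2 * (5 / X\<^sup>2)\<^sup>2"
    proof (rule mult_left_mono)
      have "\<bar>\<gamma> - t n\<bar>\<^sup>2 \<le> (5 / X\<^sup>2)\<^sup>2" using \<Delta>' by (rule power_mono) simp
      thus "(\<gamma> - t n)\<^sup>2 \<le> (5 / X\<^sup>2)\<^sup>2" by simp
    qed (use X1 in simp)
    \<comment> \<open>200 = 8 * 5^2. Of the four powers of X in the denominator, one cancels against
      the bound X for \<zeta>, one absorbs 200 / \<eta>^2, and two reproduce the assumed lower
      bound.\<close>
    also have "\<dots> = (200 / \<eta>\<^sup>2) / X * (1 / X\<^sup>2)"
      using X1 by (simp add: power2_eq_square)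
    also have "\<dots> \<le> 1 * (1 / X\<^sup>2)"
    proof (rule mult_right_mono)
      show "(200 / \<eta>\<^sup>2) / X \<le> 1" using X X1 by (subst pos_divide_le_eq) auto
    qed simp
    finally show False by simp
  qed
  from this[OF _ disjI1[OF refl]] this[OF _ disjI2[OF refl]] between(2,3) show ?thesis
    by (intro exI[of _ T] allI impI) (smt (verit))
qed

end
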